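(* Let $0<s\in\mathbb{R}$ and let $H^s(\mathbb{R}^N)$ be equipped with the norm $$\|u\|_{H^s(\mathbb{R}^N)}=\big\|(1+4\pi^2|\cdot|^2)^{s/2}\mathcal{F}u\big\|_{L_2(\mathbb{R}^N)}$$ and corresponding inner product $\langle u,v\rangle_{H^s(\mathbb{R}^N)}=\int_{\mathbb{R}^N}(1+4\pi^2|\xi|^2)^s(\mathcal{F}u)(\xi)\overline{(\mathcal{F}v)(\xi)}\,d\xi$. Then for each $u\in L_2(\mathbb{R}^N)$ the element $E_s^*u$ is given by the convolution $$(E_s^*u)(x)=(G_{2s}\ast u)(x),$$ where, for $s>0$, the convolution kernel $G_s:\mathbb{R}^N\to\mathbb{R}$ is defined by $$G_s(x):=\mathcal{F}^{-1}\Big((1+4\pi^2|\cdot|^2)^{-s/2}\Big)(x).$$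
   Context: $N\in\mathbb{N}$; $L_2(\mathbb{R}^N)$ is the complex Lebesgue space with $\langle u,v\rangle_{L_2(\mathbb{R}^N)}=\int u\overline v\,dx$. The Fourier transform is $(\mathcal{F}u)(\xi)=\int_{\mathbb{R}^N}e^{-2\pi i\xi\cdot x}u(x)\,dx$ and $(\mathcal{F}^{-1}u)(x)=\int_{\mathbb{R}^N}e^{2\pi ix\cdot\xi}u(\xi)\,d\xi$, extended to bounded, mutually inverse operators on $L_2(\mathbb{R}^N)$. In the definition of $G_s$ the inverse transform is understood in the general (tempered distribution) sense: $G_s$ is the integrable function on $\mathbb{R}^N$ with $\mathcal{F}G_s=(1+4\pi^2|\cdot|^2)^{-s/2}$. Convolution: $(u\ast v)(x)=\int_{\mathbb{R}^N}u(x-y)v(y)\,dy$. $H^s(\mathbb{R}^N)$ is the set of $u\in L_2(\mathbb{R}^N)$ with $\mathcal{F}^{-1}\big((1+4\pi^2|\cdot|^2)^{s/2}\mathcal{F}u\big)\in L_2(\mathbb{R}^N)$. $E_s:H^s(\mathbb{R}^N)\to L_2(\mathbb{R}^N)$, $E_su:=u$, is the embedding operator, and its adjoint $E_s^*:L_2(\mathbb{R}^N)\to H^s(\mathbb{R}^N)$ is defined by $\langle E_s^*u,v\rangle_{H^s(\mathbb{R}^N)}=\langle u,v\rangle_{L_2(\mathbb{R}^N)}$ for all $u\in L_2(\mathbb{R}^N)$, $v\in H^s(\mathbb{R}^N)$. *)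

theory Defs
  imports "HOL-Analysis.Analysis"
begin

text \<open>
  Elements of the Lebesgue spaces are represented by functions on \<open>real ^ 'n\<close>, with \<open>CARD('n)\<close>
  the dimension; identities between elements of these spaces are identities almost everywhere.
\<close>

definition L1_space :: "(real ^ 'n \<Rightarrow> complex) set" where
  "L1_space = {u. integrable lebesgue u}"

definition L2_space :: "(real ^ 'n \<Rightarrow> complex) set" where
  "L2_space = {u. u \<in> borel_measurable lebesgue \<and> integrable lebesgue (\<lambda>x. (cmod (u x))\<^sup>2)}"

definition L2_inner :: "(real ^ 'n \<Rightarrow> complex) \<Rightarrow> (real ^ 'n \<Rightarrow> complex) \<Rightarrow> complex" where
  "L2_inner u v = (LINT x|lebesgue. u x * cnj (v x))"

definition L2_norm :: "(real ^ 'n \<Rightarrow> complex) \<Rightarrow> real" where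
  "L2_norm u = sqrt (LINT x|lebesgue. (cmod (u x))\<^sup>2)"

text \<open>
  Convergence in the square mean, via the extended nonnegative integral: unlike the Bochner
  integral this takes the value \<open>\<infinity>\<close>, not 0, if a difference is not square integrable.
\<close>

definition L2_tendsto :: "(nat \<Rightarrow> real ^ 'n \<Rightarrow> complex) \<Rightarrow> (real ^ 'n \<Rightarrow> complex) \<Rightarrow> bool" where
  "L2_tendsto f u \<longleftrightarrow>
     (\<lambda>n. \<integral>\<^sup>+ x. ennreal ((cmod (f n x - u x))\<^sup>2) \<partial>lebesgue) \<longlonglongrightarrow> 0"

definition fourier_integral :: "(real ^ 'n \<Rightarrow> complex) \<Rightarrow> real ^ 'n \<Rightarrow> complex" where
  "fourier_integral u \<xi> = (LINT x|lebesgue. exp (- (2 * pi * \<i> * (\<xi> \<bullet> x))) * u x)"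

definition inv_fourier_integral :: "(real ^ 'n \<Rightarrow> complex) \<Rightarrow> real ^ 'n \<Rightarrow> complex" where
  "inv_fourier_integral u x = (LINT \<xi>|lebesgue. exp (2 * pi * \<i> * (x \<bullet> \<xi>)) * u \<xi>)"

text \<open>
  Extension by continuity from \<open>L1_space \<inter> L2_space\<close> to \<open>L2_space\<close>.  The value is
  determined up to null sets, and it is meaningful only for arguments in \<open>L2_space\<close>.
\<close>

definition is_L2_extension_value ::
    "((real ^ 'n \<Rightarrow> complex) \<Rightarrow> real ^ 'n \<Rightarrow> complex) \<Rightarrow>
      (real ^ 'n \<Rightarrow> complex) \<Rightarrow> (real ^ 'n \<Rightarrow> complex) \<Rightarrow> bool" where
  "is_L2_extension_value T u g \<longleftrightarrow> u \<in> L2_space \<and> g \<in> L2_space \<and>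
     (\<exists>f. (\<forall>n. f n \<in> L1_space \<inter> L2_space) \<and> L2_tendsto f u \<and> L2_tendsto (\<lambda>n. T (f n)) g)"

definition L2_fourier :: "(real ^ 'n \<Rightarrow> complex) \<Rightarrow> real ^ 'n \<Rightarrow> complex" where
  "L2_fourier u = (SOME g. is_L2_extension_value fourier_integral u g)"

definition L2_inv_fourier :: "(real ^ 'n \<Rightarrow> complex) \<Rightarrow> real ^ 'n \<Rightarrow> complex" where
  "L2_inv_fourier u = (SOME g. is_L2_extension_value inv_fourier_integral u g)"

definition bessel_weight :: "real \<Rightarrow> real ^ 'n \<Rightarrow> real" where
  "bessel_weight r \<xi> = (1 + 4 * pi\<^sup>2 * (norm \<xi>)\<^sup>2) powr r"

text \<open>
  The first membership of \<open>g\<close> below says that \<open>g\<close> lies in the domain of the inverse transform;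
  it cannot be dropped since \<open>L2_inv_fourier\<close> is a total function in HOL.
\<close>

definition Hs_space :: "real \<Rightarrow> (real ^ 'n \<Rightarrow> complex) set" where
  "Hs_space s = {u \<in> L2_space.
     let g = (\<lambda>\<xi>. of_real (bessel_weight (s / 2) \<xi>) * L2_fourier u \<xi>)
     in g \<in> L2_space \<and> L2_inv_fourier g \<in> L2_space}"

definition Hs_norm :: "real \<Rightarrow> (real ^ 'n \<Rightarrow> complex) \<Rightarrow> real" where
  "Hs_norm s u = L2_norm (\<lambda>\<xi>. of_real (bessel_weight (s / 2) \<xi>) * L2_fourier u \<xi>)"

definition Hs_inner ::
    "real \<Rightarrow> (real ^ 'n \<Rightarrow> complex) \<Rightarrow> (real ^ 'n \<Rightarrow> complex) \<Rightarrow> complex" where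
  "Hs_inner s u v =
     (LINT \<xi>|lebesgue. of_real (bessel_weight s \<xi>) * L2_fourier u \<xi> * cnj (L2_fourier v \<xi>))"

lemma Hs_inner_self: "Hs_inner s u u = of_real ((Hs_norm s u)\<^sup>2)"
proof -
  have w: "(bessel_weight (s / 2) \<xi>)\<^sup>2 = bessel_weight s \<xi>" for \<xi> :: "real ^ 'n"
    by (simp add: bessel_weight_def power2_eq_square flip: powr_add)
  have nonneg: "0 \<le> (LINT \<xi>|lebesgue. bessel_weight s \<xi> * (cmod (L2_fourier u \<xi>))\<^sup>2)"
    by (rule Bochner_Integration.integral_nonneg) (simp add: bessel_weight_def)
  have "Hs_inner s u u =
      (LINT \<xi>|lebesgue. of_real (bessel_weight s \<xi> * (cmod (L2_fourier u \<xi>))\<^sup>2))"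
    unfolding Hs_inner_def by (simp add: complex_norm_square mult.assoc del: of_real_power)
  also have "\<dots> = of_real (LINT \<xi>|lebesgue. bessel_weight s \<xi> * (cmod (L2_fourier u \<xi>))\<^sup>2)"
    by (rule integral_complex_of_real)
  also have "(LINT \<xi>|lebesgue. bessel_weight s \<xi> * (cmod (L2_fourier u \<xi>))\<^sup>2) = (Hs_norm s u)\<^sup>2"
    by (simp add: Hs_norm_def L2_norm_def norm_mult power_mult_distrib w nonneg)
  finally show ?thesis .
qed

definition Hs_embedding :: "(real ^ 'n \<Rightarrow> complex) \<Rightarrow> real ^ 'n \<Rightarrow> complex" where
  "Hs_embedding u = u"

text \<open>\<open>S\<close> (choosing representatives) is the adjoint of the embedding of \<open>Hs_space s\<close> into \<open>L2_space\<close>.\<close>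

definition is_Hs_embedding_adjoint ::
    "real \<Rightarrow> ((real ^ 'n \<Rightarrow> complex) \<Rightarrow> real ^ 'n \<Rightarrow> complex) \<Rightarrow> bool" where
  "is_Hs_embedding_adjoint s S \<longleftrightarrow>
     (\<forall>u \<in> L2_space. S u \<in> Hs_space s \<and>
        (\<forall>v \<in> Hs_space s. Hs_inner s (S u) v = L2_inner u (Hs_embedding v)))"

text \<open>
  The kernel is the integrable function whose Fourier transform is the given symbol (the inverse
  transform of the symbol in the sense of tempered distributions); it is unique up to null sets,
  which do not affect convolutions.
\<close>

definition is_bessel_kernel :: "real \<Rightarrow> (real ^ 'n \<Rightarrow> real) \<Rightarrow> bool" where
  "is_bessel_kernel s G \<longleftrightarrow> integrable lebesgue G \<and>
     (\<forall>\<xi>. fourier_integral (\<lambda>x. of_real (G x)) \<xi> = of_real (bessel_weight (- s / 2) \<xi>))"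

definition bessel_kernel :: "real \<Rightarrow> real ^ 'n \<Rightarrow> real" where
  "bessel_kernel s = (SOME G. is_bessel_kernel s G)"

definition convolution ::
    "(real ^ 'n \<Rightarrow> complex) \<Rightarrow> (real ^ 'n \<Rightarrow> complex) \<Rightarrow> real ^ 'n \<Rightarrow> complex" where
  "convolution u v x = (LINT y|lebesgue. u (x - y) * v y)"

end

theory Submission
  imports "HOL-Probability.Characteristic_Functions" Defs
begin

text \<open>
  For \<open>u\<close> in \<open>L2\<close> put \<open>k = G * u\<close>, where \<open>G\<close> is integrable with Fourier transform
  \<open>w^(-s)\<close>, \<open>w \<xi> = 1 + 4 \<pi>\<^sup>2 |\<xi>|\<^sup>2\<close>.  The convolution theorem gives \<open>F k = w^(-s) F u\<close>.  Hence
  \<open>w^(s/2) F k = w^(-s/2) F u\<close> is square integrable, so \<open>k\<close> lies in the Sobolev space, and for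
  every \<open>v\<close> in that space the weights cancel:
  \<open>\<langle>k, v\<rangle>\<^sub>H = \<integral> w^s (w^(-s) F u) cnj (F v) = \<integral> F u cnj (F v) = \<langle>u, v\<rangle>\<close>
  by Parseval's identity (\<open>Hs_inner_convolution_bessel_kernel\<close>).  This is the defining property of
  the adjoint, and it determines \<open>k\<close> almost everywhere because the Sobolev inner product is
  definite and the Fourier transform is injective on \<open>L2\<close> (\<open>Hs_inner_determines_AE\<close>).

  The kernel exists by subordination to the heat kernel: integrating
  \<open>t^(s-1) exp (-t) / \<Gamma>(s)\<close> times the heat kernel at time \<open>t\<close> over \<open>t > 0\<close> turns the Gaussian symbol
  \<open>exp (-4 \<pi>\<^sup>2 |\<xi>|\<^sup>2 t)\<close> into \<open>w^(-s)\<close>, by Euler's integral for the Gamma function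
  (\<open>is_bessel_kernel_subordination\<close>).

  The Plancherel theory on which this rests is derived from two facts: the multiplication
  formula \<open>\<integral> (F u) v = \<integral> u (F v)\<close> for integrable \<open>u\<close>, \<open>v\<close>, and the Fourier transform of a Gaussian.
  Together they identify the inverse transform of a Gaussian times \<open>F f\<close> with a Gaussian average of
  \<open>f\<close> (\<open>signed_fourier_gaussian_regularization\<close>).  Testing this against \<open>cnj f\<close>, with Young's
  inequality, shows that \<open>F\<close> is a contraction for the \<open>L2\<close> norm
  (\<open>L2_energy_signed_fourier_le\<close>), so that its extension by continuity exists, \<open>L2\<close> being
  complete, and is unique.
  Testing it against continuous functions of compact support, for which Gaussian averages converge
  pointwise, shows that the inverse transform undoes \<open>F\<close>
  (\<open>fourier_value_inversion\<close>).  Parseval's identity then follows from the multiplication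
  formula and inversion; neither Schwartz functions nor continuity of translations in \<open>L2\<close> is used.
\<close>

section \<open>The Fourier integral\<close>

text \<open>
  The Fourier integral with phase \<open>2 \<pi> \<sigma> (\<xi> \<bullet> x)\<close>.  The values \<open>\<sigma> = -1\<close> and \<open>\<sigma> = 1\<close> give the
  transform and its inverse, so that statements for \<open>|\<sigma>| = 1\<close> cover both.
\<close>

definition signed_fourier :: "real \<Rightarrow> (real ^ 'n \<Rightarrow> complex) \<Rightarrow> real ^ 'n \<Rightarrow> complex" where
  "signed_fourier \<sigma> u \<xi> = (LINT x|lebesgue. cis (2 * pi * \<sigma> * (\<xi> \<bullet> x)) * u x)"

lemma fourier_integral_eq_signed: "fourier_integral = signed_fourier (-1)"
  by (intro ext) (simp add: fourier_integral_def signed_fourier_def cis_conv_exp algebra_simps)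

lemma inv_fourier_integral_eq_signed: "inv_fourier_integral = signed_fourier 1"
  by (intro ext) (simp add: inv_fourier_integral_def signed_fourier_def cis_conv_exp algebra_simps)

text \<open>
  Lebesgue measurable functions are replaced by Borel functions before any use of Fubini's theorem,
  since for a Lebesgue measurable \<open>G\<close> the function \<open>G (x - y)\<close> of \<open>(x, y)\<close> need not be measurable for
  the product of two Lebesgue \<open>\<sigma>\<close>-algebras.
\<close>

lemma lebesgue_measurable_eq_borel_AE:
  fixes u :: "real ^ 'n \<Rightarrow> complex"
  assumes "u \<in> borel_measurable lebesgue"
  obtains v where "v \<in> borel_measurable borel" "AE x in lebesgue. u x = v x"
proof -
  have "(\<lambda>x. Re (u x)) \<in> borel_measurable lebesgue"
    using assms by measurable
  then obtain r where r: "r \<in> borel_measurable lborel" "AE x in lborel. Re (u x) = r x"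
    using completion_ex_borel_measurable_real by blast
  have "(\<lambda>x. Im (u x)) \<in> borel_measurable lebesgue"
    using assms by measurable
  then obtain i where i: "i \<in> borel_measurable lborel" "AE x in lborel. Im (u x) = i x"
    using completion_ex_borel_measurable_real by blast
  note [measurable] = r(1) i(1) and ae = r(2) i(2)
  have "(\<lambda>x. of_real (r x) + \<i> * of_real (i x) :: complex) \<in> borel_measurable borel"
    by measurable
  moreover have "AE x in lebesgue. u x = of_real (r x) + \<i> * of_real (i x)"
    by (intro AE_completion) (use ae in eventually_elim, simp add: complex_eq_iff)
  ultimately show thesis using that by blast
qed

lemma cis_measurable [measurable]: "f \<in> borel_measurable M \<Longrightarrow> (\<lambda>x. cis (f x)) \<in> borel_measurable M"
  by (simp add: cis_conv_exp)

lemma borel_imp_lebesgue_measurable: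
  "f \<in> borel_measurable borel \<Longrightarrow> f \<in> borel_measurable lebesgue"
  by (intro measurable_completion) simp

lemma integrable_eq_borel_AE:
  fixes u :: "real ^ 'n \<Rightarrow> complex"
  assumes "integrable lebesgue u"
  obtains v where "integrable lborel v" "v \<in> borel_measurable borel" "AE x in lebesgue. u x = v x"
proof -
  obtain v where v: "v \<in> borel_measurable borel" "AE x in lebesgue. u x = v x"
    using lebesgue_measurable_eq_borel_AE[OF borel_measurable_integrable[OF assms]] by blast
  have "integrable lebesgue v"
    using assms v(2) borel_measurable_integrable[OF assms] borel_imp_lebesgue_measurable[OF v(1)]
    by (subst integrable_cong_AE[symmetric, of u]) auto
  then show thesis using that v integrable_completion[of v lborel] by auto
qed

lemma phase_measurable [measurable]:
  fixes \<xi> :: "real ^ 'n"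
  shows "(\<lambda>x. cis (c * (\<xi> \<bullet> x))) \<in> borel_measurable lebesgue"
  by (intro borel_imp_lebesgue_measurable) measurable

lemma integrable_phase_mult:
  fixes u :: "real ^ 'n \<Rightarrow> complex"
  assumes "integrable lebesgue u"
  shows "integrable lebesgue (\<lambda>x. cis (c * (\<xi> \<bullet> x)) * u x)"
  by (rule Bochner_Integration.integrable_bound[OF assms])
     (use assms in \<open>auto simp: norm_mult intro!: borel_measurable_times phase_measurable\<close>)

lemma signed_fourier_cong_AE:
  assumes "u \<in> borel_measurable lebesgue" "v \<in> borel_measurable lebesgue" "AE x in lebesgue. u x = v x"
  shows "signed_fourier \<sigma> u = signed_fourier \<sigma> v"
  unfolding signed_fourier_def
  by (intro ext integral_cong_AE borel_measurable_times phase_measurable assms(1,2))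
     (use assms(3) in eventually_elim, simp)

lemma signed_fourier_borel:
  assumes [measurable]: "v \<in> borel_measurable borel"
  shows "signed_fourier \<sigma> v \<xi> = (LINT x|lborel. cis (2 * pi * \<sigma> * (\<xi> \<bullet> x)) * v x)"
  unfolding signed_fourier_def by (intro integral_completion) measurable

lemma signed_fourier_measurable:
  fixes u :: "real ^ 'n \<Rightarrow> complex"
  assumes "integrable lebesgue u"
  shows "signed_fourier \<sigma> u \<in> borel_measurable borel"
proof -
  obtain v where v: "integrable lborel v" "v \<in> borel_measurable borel" "AE x in lebesgue. u x = v x"
    using integrable_eq_borel_AE[OF assms] .
  note [measurable] = v(2)
  have "signed_fourier \<sigma> u = signed_fourier \<sigma> v"
    by (rule signed_fourier_cong_AE[OF borel_measurable_integrable[OF assms] borel_imp_lebesgue_measurable[OF v(2)] v(3)])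
  also have "\<dots> = (\<lambda>\<xi>. LINT x|lborel. cis (2 * pi * \<sigma> * (\<xi> \<bullet> x)) * v x)"
    by (intro ext signed_fourier_borel) measurable
  also have "\<dots> \<in> borel_measurable borel"
    by measurable
  finally show ?thesis .
qed

lemma norm_signed_fourier_le:
  "cmod (signed_fourier \<sigma> u \<xi>) \<le> (LINT x|lebesgue. cmod (u x))"
  unfolding signed_fourier_def
  by (rule integral_norm_bound[THEN order_trans]) (simp add: norm_mult)

lemma integrable_signed_fourier_mult:
  fixes u v :: "real ^ 'n \<Rightarrow> complex"
  assumes "integrable lebesgue u" "integrable lebesgue v"
  shows "integrable lebesgue (\<lambda>x. signed_fourier \<sigma> u x * v x)"
proof (rule Bochner_Integration.integrable_bound)
  show "integrable lebesgue (\<lambda>x. (LINT x|lebesgue. cmod (u x)) * cmod (v x))"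
    using assms by simp
  show "(\<lambda>x. signed_fourier \<sigma> u x * v x) \<in> borel_measurable lebesgue"
    by (intro borel_measurable_times borel_imp_lebesgue_measurable[OF signed_fourier_measurable]
        borel_measurable_integrable assms)
  show "AE x in lebesgue. norm (signed_fourier \<sigma> u x * v x) \<le> norm ((LINT x|lebesgue. cmod (u x)) * cmod (v x))"
    by (auto simp: norm_mult abs_mult intro!: mult_right_mono order_trans[OF norm_signed_fourier_le])
qed

lemma signed_fourier_multiplication:
  fixes u v :: "real ^ 'n \<Rightarrow> complex"
  assumes u: "integrable lebesgue u" and v: "integrable lebesgue v"
  shows "(LINT x|lebesgue. signed_fourier \<sigma> u x * v x) = (LINT x|lebesgue. u x * signed_fourier \<sigma> v x)"
proof -
  obtain f where f: "integrable lborel f" "f \<in> borel_measurable borel" "AE x in lebesgue. u x = f x"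
    using integrable_eq_borel_AE[OF u] .
  obtain g where g: "integrable lborel g" "g \<in> borel_measurable borel" "AE x in lebesgue. v x = g x"
    using integrable_eq_borel_AE[OF v] .
  note [measurable] = f(2) g(2)
  have [measurable]: "u \<in> borel_measurable lebesgue" "v \<in> borel_measurable lebesgue" using u v by auto
  have fg_leb: "integrable lebesgue f" "integrable lebesgue g"
    using f(1) g(1) integrable_completion[of f lborel] integrable_completion[of g lborel] by auto
  have [measurable]: "signed_fourier \<sigma> f \<in> borel_measurable borel" "signed_fourier \<sigma> g \<in> borel_measurable borel"
    using signed_fourier_measurable fg_leb by blast+
  have uf: "signed_fourier \<sigma> u = signed_fourier \<sigma> f"
    by (rule signed_fourier_cong_AE[OF borel_measurable_integrable[OF u] borel_imp_lebesgue_measurable[OF f(2)] f(3)])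
  have vg: "signed_fourier \<sigma> v = signed_fourier \<sigma> g"
    by (rule signed_fourier_cong_AE[OF borel_measurable_integrable[OF v] borel_imp_lebesgue_measurable[OF g(2)] g(3)])
  let ?K = "\<lambda>x y. cis (2 * pi * \<sigma> * (x \<bullet> y)) * f y * g x"
  have "integrable (lborel \<Otimes>\<^sub>M lborel) (case_prod ?K)"
  proof (rule lborel_pair.Fubini_integrable)
    show "case_prod ?K \<in> borel_measurable (lborel \<Otimes>\<^sub>M lborel)" by measurable
    have "integrable lborel (\<lambda>x. (LINT y|lborel. cmod (f y)) * cmod (g x))" using g by simp
    then show "integrable lborel (\<lambda>x. LINT y|lborel. norm (case (x, y) of (x, y) \<Rightarrow> ?K x y))"
      by (simp add: norm_mult)
    have "integrable lborel (\<lambda>y. ?K x y)" for x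
      by (rule Bochner_Integration.integrable_bound[of _ "\<lambda>y. cmod (g x) * cmod (f y)"])
         (use f in \<open>auto simp: norm_mult\<close>)
    then show "AE x in lborel. integrable lborel (\<lambda>y. case (x, y) of (x, y) \<Rightarrow> ?K x y)" by simp
  qed
  from lborel_pair.Fubini_integral[OF this]
  have "(LINT y|lborel. LINT x|lborel. ?K x y) = (LINT x|lborel. LINT y|lborel. ?K x y)" .
  moreover have "(LINT y|lborel. ?K x y) = signed_fourier \<sigma> f x * g x" for x
    by (simp add: signed_fourier_borel)
  moreover have "(LINT x|lborel. ?K x y) = f y * signed_fourier \<sigma> g y" for y
  proof -
    have "?K x y = f y * (cis (2 * pi * \<sigma> * (y \<bullet> x)) * g x)" for x
      by (simp add: inner_commute)
    then have "(LINT x|lborel. ?K x y) = (LINT x|lborel. f y * (cis (2 * pi * \<sigma> * (y \<bullet> x)) * g x))"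
      by (simp only:)
    then show ?thesis by (simp add: signed_fourier_borel)
  qed
  ultimately have eq: "(LINT y|lborel. f y * signed_fourier \<sigma> g y) = (LINT x|lborel. signed_fourier \<sigma> f x * g x)"
    by (simp only:)
  have "(LINT x|lebesgue. signed_fourier \<sigma> u x * v x) = (LINT x|lebesgue. signed_fourier \<sigma> f x * g x)"
    unfolding uf by (rule integral_cong_AE)
      (use g(3) in \<open>auto intro!: borel_measurable_times borel_imp_lebesgue_measurable[of "signed_fourier _ _"]
        borel_imp_lebesgue_measurable[of g]\<close>)
  also have "\<dots> = (LINT x|lborel. signed_fourier \<sigma> f x * g x)"
    by (intro integral_completion) measurable
  also have "\<dots> = (LINT x|lborel. f x * signed_fourier \<sigma> g x)" using eq by simp
  also have "\<dots> = (LINT x|lebesgue. f x * signed_fourier \<sigma> g x)"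
    by (intro integral_completion[symmetric]) measurable
  also have "\<dots> = (LINT x|lebesgue. u x * signed_fourier \<sigma> v x)"
    unfolding vg by (rule integral_cong_AE)
      (use f(3) in \<open>auto intro!: borel_measurable_times borel_imp_lebesgue_measurable[of "signed_fourier _ _"]
        borel_imp_lebesgue_measurable[of f]\<close>)
  finally show ?thesis .
qed

lemma cnj_signed_fourier: "cnj (signed_fourier \<sigma> u \<xi>) = signed_fourier (-\<sigma>) (\<lambda>x. cnj (u x)) \<xi>"
proof -
  have "cnj (signed_fourier \<sigma> u \<xi>) = (LINT x|lebesgue. cnj (cis (2 * pi * \<sigma> * (\<xi> \<bullet> x)) * u x))"
    unfolding signed_fourier_def by (simp only: Bochner_Integration.integral_cnj)
  then show ?thesis by (simp add: signed_fourier_def cis_cnj)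
qed

lemma signed_fourier_modulation:
  "signed_fourier \<sigma> (\<lambda>x. cis (- (2 * pi * \<sigma> * (a \<bullet> x))) * u x) \<xi> = signed_fourier \<sigma> u (\<xi> - a)"
proof -
  have "cis (2 * pi * \<sigma> * (\<xi> \<bullet> x)) * (cis (- (2 * pi * \<sigma> * (a \<bullet> x))) * u x)
      = cis (2 * pi * \<sigma> * ((\<xi> - a) \<bullet> x)) * u x" for x
    unfolding mult.assoc[symmetric] cis_mult by (simp add: inner_diff_left right_diff_distrib)
  then show ?thesis unfolding signed_fourier_def by (simp only:)
qed

section \<open>Gaussians\<close>

text \<open>
  The one-dimensional formula is the characteristic function of the standard normal distribution,
  rescaled by \<open>c = sqrt (2 \<pi> a)\<close>.
\<close>

lemma fourier_gaussian_real:
  fixes a b :: real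
  assumes a: "0 < a"
  shows "integrable lborel (\<lambda>y. cis (2 * pi * b * y) * of_real (exp (- pi * a * y\<^sup>2)))" (is ?I)
    and "(LINT y|lborel. cis (2 * pi * b * y) * of_real (exp (- pi * a * y\<^sup>2)))
           = of_real (exp (- pi * b\<^sup>2 / a) / sqrt a)" (is ?E)
proof -
  define c where "c = sqrt (2 * pi * a)"
  define t where "t = 2 * pi * b / c"
  have c: "c > 0" "c\<^sup>2 = 2 * pi * a" using a by (simp_all add: c_def)
  have t2: "t\<^sup>2 / 2 = pi * b\<^sup>2 / a"
    using a by (simp add: t_def power_divide c(2)) (simp add: power2_eq_square field_simps)
  have tc: "t * (c * y) = 2 * pi * b * y" for y using c by (simp add: t_def)
  have e: "- (c * y)\<^sup>2 / 2 = - pi * a * y\<^sup>2" for y unfolding power_mult_distrib c(2) by simp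
  let ?h = "\<lambda>x. std_normal_density x *\<^sub>R cis (t * x)"
  have hint: "integrable lborel ?h"
    by (rule Bochner_Integration.integrable_bound[of _ std_normal_density]) (auto simp: normal_density_nonneg)
  have h: "(LINT x|lborel. ?h x) = of_real (exp (- (t\<^sup>2) / 2))"
  proof -
    have "(LINT x|lborel. ?h x) = char std_normal_distribution t"
      unfolding char_def by (subst integral_density) (auto simp: cis_conv_exp normal_density_nonneg)
    then show ?thesis by (simp add: char_std_normal_distribution)
  qed
  have hc: "?h (0 + c * y) = cis (2 * pi * b * y) * of_real (exp (- pi * a * y\<^sup>2)) / of_real (sqrt (2 * pi))" for y
    unfolding add_0 tc std_normal_density_def e by (simp add: scaleR_conv_of_real)
  have "integrable lborel (\<lambda>y. ?h (0 + c * y))"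
    using lborel_integrable_real_affine[OF hint, of c 0] c by simp
  then have "integrable lborel (\<lambda>y. ?h (0 + c * y) * of_real (sqrt (2 * pi)))"
    by (rule integrable_mult_left)
  then show ?I unfolding hc by simp
  have "of_real (exp (- (t\<^sup>2) / 2)) = c *\<^sub>R (LINT y|lborel. ?h (0 + c * y))"
    using lborel_integral_real_affine[of c ?h 0] c h by simp
  also have "\<dots> = c *\<^sub>R ((LINT y|lborel. cis (2 * pi * b * y) * of_real (exp (- pi * a * y\<^sup>2))) / of_real (sqrt (2 * pi)))"
    unfolding hc by simp
  finally have "(LINT y|lborel. cis (2 * pi * b * y) * of_real (exp (- pi * a * y\<^sup>2)))
     = of_real (exp (- (t\<^sup>2) / 2) * sqrt (2 * pi) / c)"
    using c by (simp add: scaleR_conv_of_real field_simps)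
  also have "exp (- (t\<^sup>2) / 2) * sqrt (2 * pi) / c = exp (- pi * b\<^sup>2 / a) / sqrt a"
    using t2 by (simp add: c_def real_sqrt_mult)
  finally show ?E .
qed

lemma lborel_integral_prod_Basis:
  fixes f :: "'a::euclidean_space \<Rightarrow> real \<Rightarrow> complex"
  assumes f: "\<And>b. b \<in> Basis \<Longrightarrow> integrable lborel (f b)"
  shows "integrable lborel (\<lambda>x. \<Prod>b\<in>Basis. f b (x \<bullet> b))" (is ?I)
    and "(LINT x|lborel. (\<Prod>b\<in>Basis. f b (x \<bullet> b))) = (\<Prod>b\<in>Basis. LINT y|lborel. f b y)" (is ?E)
proof -
  interpret product_sigma_finite "\<lambda>_::'a. lborel :: real measure" by standard
  have [measurable]: "b \<in> Basis \<Longrightarrow> f b \<in> borel_measurable borel" for b using f[of b] by auto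
  have m: "(\<lambda>x::'a. \<Prod>b\<in>Basis. f b (x \<bullet> b)) \<in> borel_measurable borel" by measurable
  have T: "(\<lambda>f. \<Sum>b\<in>Basis. f b *\<^sub>R b) \<in> (\<Pi>\<^sub>M b\<in>(Basis::'a set). lborel) \<rightarrow>\<^sub>M borel" by measurable
  have eq: "(\<Prod>b\<in>Basis. f b ((\<Sum>b\<in>Basis. x b *\<^sub>R b) \<bullet> b)) = (\<Prod>b\<in>Basis. f b (x b))" for x
    by (intro prod.cong) auto
  have "integrable (\<Pi>\<^sub>M b\<in>(Basis::'a set). lborel) (\<lambda>x. \<Prod>b\<in>Basis. f b (x b))"
    using f by (intro product_integrable_prod) auto
  then show ?I
    by (subst lborel_eq, subst integrable_distr_eq[OF T m]) (simp add: eq)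
  have "(LINT x|lborel. (\<Prod>b\<in>Basis. f b (x \<bullet> b))) = (LINT x|(\<Pi>\<^sub>M b\<in>(Basis::'a set). lborel). (\<Prod>b\<in>Basis. f b (x b)))"
    by (subst lborel_eq, subst integral_distr[OF T m]) (simp add: eq)
  also have "\<dots> = (\<Prod>b\<in>Basis. LINT y|lborel. f b y)"
    using f by (intro product_integral_prod) auto
  finally show ?E .
qed

text \<open>
  Gaussians normalized so that \<open>gaussian 1\<close> is its own Fourier transform.
\<close>

definition gaussian :: "real \<Rightarrow> real ^ 'n \<Rightarrow> real" where
  "gaussian a x = exp (- pi * a * (norm x)\<^sup>2)"

lemma gaussian_measurable [measurable]: "gaussian a \<in> borel_measurable borel"
  unfolding gaussian_def[abs_def] by measurable

lemma phase_gaussian_prod: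
  fixes x \<xi> :: "real ^ 'n"
  shows "cis (2 * pi * \<sigma> * (\<xi> \<bullet> x)) * of_real (gaussian a x)
    = (\<Prod>b\<in>Basis. cis (2 * pi * (\<sigma> * (\<xi> \<bullet> b)) * (x \<bullet> b)) * of_real (exp (- pi * a * (x \<bullet> b)\<^sup>2)))"
proof -
  have "cis (2 * pi * \<sigma> * (\<xi> \<bullet> x)) = (\<Prod>b\<in>Basis. cis (2 * pi * (\<sigma> * (\<xi> \<bullet> b)) * (x \<bullet> b)))"
    unfolding cis_conv_exp exp_sum[OF finite_Basis, symmetric]
    by (subst euclidean_inner) (simp add: sum_distrib_left mult_ac)
  moreover have "gaussian a x = (\<Prod>b\<in>Basis. exp (- pi * a * (x \<bullet> b)\<^sup>2))"
    unfolding gaussian_def exp_sum[OF finite_Basis, symmetric] power2_norm_eq_inner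
    by (subst euclidean_inner) (simp add: sum_distrib_left power2_eq_square sum_negf)
  ultimately show ?thesis by (simp add: prod.distrib)
qed

lemma
  fixes \<xi> :: "real ^ 'n"
  assumes a: "0 < a" and \<sigma>: "\<bar>\<sigma>\<bar> = 1"
  shows integrable_phase_gaussian: "integrable lborel (\<lambda>x. cis (2 * pi * \<sigma> * (\<xi> \<bullet> x)) * of_real (gaussian a x))" (is ?I)
    and signed_fourier_gaussian: "signed_fourier \<sigma> (\<lambda>x. of_real (gaussian a x)) \<xi>
        = of_real (gaussian (1 / a) \<xi> / sqrt a ^ CARD('n))" (is ?E)
proof -
  have sq: "\<sigma>\<^sup>2 = 1" using \<sigma> by (simp add: abs_square_eq_1)
  show ?I
    unfolding phase_gaussian_prod
    by (intro lborel_integral_prod_Basis(1) fourier_gaussian_real(1) a)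
  have "signed_fourier \<sigma> (\<lambda>x. of_real (gaussian a x)) \<xi> =
     (LINT x|lborel. cis (2 * pi * \<sigma> * (\<xi> \<bullet> x)) * of_real (gaussian a x))"
    by (intro signed_fourier_borel) measurable
  also have "\<dots> = (\<Prod>b\<in>Basis. of_real (exp (- pi * (\<sigma> * (\<xi> \<bullet> b))\<^sup>2 / a) / sqrt a))"
    unfolding phase_gaussian_prod
    by (subst lborel_integral_prod_Basis(2))
       (intro fourier_gaussian_real(1) a, intro prod.cong refl fourier_gaussian_real(2) a)
  also have "\<dots> = of_real ((\<Prod>b\<in>Basis. exp (- pi * (1 / a) * (\<xi> \<bullet> b)\<^sup>2)) / sqrt a ^ CARD('n))"
    using sq by (simp add: prod_dividef power_mult_distrib)
  also have "(\<Prod>b\<in>Basis. exp (- pi * (1 / a) * (\<xi> \<bullet> b)\<^sup>2)) = gaussian (1 / a) \<xi>"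
    unfolding gaussian_def exp_sum[OF finite_Basis, symmetric] power2_norm_eq_inner
    by (subst euclidean_inner) (simp add: sum_distrib_left power2_eq_square sum_negf)
  finally show ?E .
qed

lemma integrable_gaussian:
  assumes "0 < a" shows "integrable lborel (gaussian a :: real ^ 'n \<Rightarrow> real)"
proof -
  have "integrable lborel (\<lambda>x::real^'n. cis (2 * pi * 1 * (0 \<bullet> x)) * of_real (gaussian a x))"
    by (rule integrable_phase_gaussian) (use assms in auto)
  from integrable_norm[OF this] show ?thesis by (simp add: norm_mult gaussian_def[abs_def])
qed

section \<open>Square integrable functions\<close>

text \<open>
  The square of the \<open>L2\<close> norm, infinite for measurable functions outside \<open>L2_space\<close>.  Estimates up to constant factors
  suffice throughout, so the crude inequality \<open>L2_energy_add_le\<close> stands in for Minkowski's.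
\<close>

definition L2_energy :: "(real ^ 'n \<Rightarrow> complex) \<Rightarrow> ennreal" where
  "L2_energy u = (\<integral>\<^sup>+ x. ennreal ((cmod (u x))\<^sup>2) \<partial>lebesgue)"

lemma L2_tendsto_iff_energy: "L2_tendsto f u \<longleftrightarrow> (\<lambda>n. L2_energy (\<lambda>x. f n x - u x)) \<longlonglongrightarrow> 0"
  by (simp add: L2_tendsto_def L2_energy_def)

lemma L2_space_iff_energy: "u \<in> L2_space \<longleftrightarrow> u \<in> borel_measurable lebesgue \<and> L2_energy u < \<infinity>"
  by (auto simp: L2_space_def L2_energy_def integrable_iff_bounded)

lemma L2_space_measurable [measurable_dest]: "u \<in> L2_space \<Longrightarrow> u \<in> borel_measurable lebesgue"
  by (simp add: L2_space_def)

lemma L2_energy_cong_AE: "AE x in lebesgue. u x = v x \<Longrightarrow> L2_energy u = L2_energy v"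
  unfolding L2_energy_def by (rule nn_integral_cong_AE) (auto elim: eventually_mono)

lemma L2_energy_commute: "L2_energy (\<lambda>x. u x - v x) = L2_energy (\<lambda>x. v x - u x)"
  by (simp add: L2_energy_def norm_minus_commute)

lemma L2_energy_cnj [simp]: "L2_energy (\<lambda>x. cnj (u x)) = L2_energy u"
  by (simp add: L2_energy_def)

lemma L2_energy_add_le:
  assumes [measurable]: "u \<in> borel_measurable lebesgue" "v \<in> borel_measurable lebesgue"
  shows "L2_energy (\<lambda>x. u x + v x) \<le> 2 * L2_energy u + 2 * L2_energy v"
proof -
  have "(cmod (a + b))\<^sup>2 \<le> 2 * (cmod a)\<^sup>2 + 2 * (cmod b)\<^sup>2" for a b
  proof -
    have "(cmod (a + b))\<^sup>2 \<le> (cmod a + cmod b)\<^sup>2" by (intro power_mono norm_triangle_ineq) auto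
    also have "\<dots> \<le> 2 * (cmod a)\<^sup>2 + 2 * (cmod b)\<^sup>2"
      using sum_squares_bound[of "cmod a" "cmod b"] by (simp add: power2_sum)
    finally show ?thesis .
  qed
  then have "L2_energy (\<lambda>x. u x + v x) \<le>
      (\<integral>\<^sup>+ x. 2 * ennreal ((cmod (u x))\<^sup>2) + 2 * ennreal ((cmod (v x))\<^sup>2) \<partial>lebesgue)"
    unfolding L2_energy_def
    by (intro nn_integral_mono) (simp flip: ennreal_plus ennreal_mult'' ennreal_numeral add: ennreal_leI)
  also have "\<dots> = 2 * L2_energy u + 2 * L2_energy v"
    unfolding L2_energy_def by (simp add: nn_integral_add nn_integral_cmult)
  finally show ?thesis .
qed

lemma L2_energy_diff_le:
  assumes [measurable]: "u \<in> borel_measurable lebesgue" "v \<in> borel_measurable lebesgue"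
    "w \<in> borel_measurable lebesgue"
  shows "L2_energy (\<lambda>x. u x - w x) \<le> 2 * L2_energy (\<lambda>x. u x - v x) + 2 * L2_energy (\<lambda>x. v x - w x)"
  using L2_energy_add_le[of "\<lambda>x. u x - v x" "\<lambda>x. v x - w x"] by simp

lemma L2_energy_mult_le:
  assumes "\<And>x. cmod (m x) \<le> C" and [measurable]: "u \<in> borel_measurable lebesgue"
  shows "L2_energy (\<lambda>x. m x * u x) \<le> ennreal (C\<^sup>2) * L2_energy u"
proof -
  have "L2_energy (\<lambda>x. m x * u x) \<le> (\<integral>\<^sup>+ x. ennreal (C\<^sup>2) * ennreal ((cmod (u x))\<^sup>2) \<partial>lebesgue)"
    unfolding L2_energy_def
    by (intro nn_integral_mono)
       (auto simp: norm_mult power_mult_distrib assms intro!: ennreal_leI mult_right_mono power_mono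
             simp flip: ennreal_mult)
  also have "\<dots> = ennreal (C\<^sup>2) * L2_energy u"
    unfolding L2_energy_def by (rule nn_integral_cmult) measurable
  finally show ?thesis .
qed

lemma L2_energy_diff_eq_0_iff:
  assumes [measurable]: "u \<in> borel_measurable lebesgue" "v \<in> borel_measurable lebesgue"
  shows "L2_energy (\<lambda>x. u x - v x) = 0 \<longleftrightarrow> (AE x in lebesgue. u x = v x)"
  unfolding L2_energy_def by (subst nn_integral_0_iff_AE) auto

lemma L2_space_cong_AE:
  assumes "u \<in> L2_space" "v \<in> borel_measurable lebesgue" "AE x in lebesgue. u x = v x"
  shows "v \<in> L2_space"
  using assms L2_energy_cong_AE[OF assms(3)] by (simp add: L2_space_iff_energy)

lemma L2_space_add:
  assumes "u \<in> L2_space" "v \<in> L2_space" shows "(\<lambda>x. u x + v x) \<in> L2_space"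
proof -
  have [measurable]: "u \<in> borel_measurable lebesgue" "v \<in> borel_measurable lebesgue"
    using assms by (auto simp: L2_space_iff_energy)
  have "2 * L2_energy u + 2 * L2_energy v < \<infinity>"
    using assms by (auto simp: L2_space_iff_energy ennreal_mult_less_top)
  then show ?thesis
    using L2_energy_add_le[of u v] by (auto simp: L2_space_iff_energy intro: le_less_trans)
qed

lemma L2_space_cnj: "u \<in> L2_space \<Longrightarrow> (\<lambda>x. cnj (u x)) \<in> L2_space"
  by (auto simp: L2_space_iff_energy intro: measurable_compose[OF _ borel_measurable_continuous_onI[OF continuous_on_cnj]])

lemma L2_space_mult:
  assumes "u \<in> L2_space" "m \<in> borel_measurable lebesgue" "\<And>x. cmod (m x) \<le> C"
  shows "(\<lambda>x. m x * u x) \<in> L2_space"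
proof -
  have [measurable]: "u \<in> borel_measurable lebesgue" "m \<in> borel_measurable lebesgue"
    using assms by (auto simp: L2_space_iff_energy)
  have "ennreal (C\<^sup>2) * L2_energy u < \<infinity>"
    using assms by (auto simp: L2_space_iff_energy ennreal_mult_less_top)
  then show ?thesis
    using L2_energy_mult_le[of m C u] assms(3) by (auto simp: L2_space_iff_energy intro: le_less_trans)
qed

lemma L2_space_diff:
  assumes "u \<in> L2_space" "v \<in> L2_space" shows "(\<lambda>x. u x - v x) \<in> L2_space"
  using L2_space_add[OF assms(1) L2_space_mult[OF assms(2), of "\<lambda>_. -1" 1]] by simp

lemma nn_integral_L2_mult_le:
  assumes [measurable]: "u \<in> borel_measurable lebesgue" "v \<in> borel_measurable lebesgue"
  shows "(\<integral>\<^sup>+ x. ennreal (cmod (u x * v x)) \<partial>lebesgue)\<^sup>2 \<le> L2_energy u * L2_energy v"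
  using Cauchy_Schwarz_nn_integral[of "\<lambda>x. ennreal (cmod (u x))" lebesgue "\<lambda>x. ennreal (cmod (v x))"]
  by (simp add: L2_energy_def norm_mult ennreal_mult ennreal_power)

lemma integrable_L2_mult:
  assumes "u \<in> L2_space" "v \<in> L2_space"
  shows "integrable lebesgue (\<lambda>x. u x * v x)"
proof -
  have [measurable]: "u \<in> borel_measurable lebesgue" "v \<in> borel_measurable lebesgue"
    using assms by (auto simp: L2_space_iff_energy)
  have "(\<integral>\<^sup>+ x. ennreal (cmod (u x * v x)) \<partial>lebesgue)\<^sup>2 < \<infinity>"
    using nn_integral_L2_mult_le[of u v] assms
    by (auto simp: L2_space_iff_energy ennreal_mult_less_top intro: le_less_trans)
  then have "(\<integral>\<^sup>+ x. ennreal (cmod (u x * v x)) \<partial>lebesgue) < \<infinity>"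
    by (auto simp: power2_eq_square ennreal_mult_less_top less_top)
  then show ?thesis by (auto simp: integrable_iff_bounded)
qed

lemma norm_integral_L2_mult_le:
  assumes "u \<in> L2_space" "v \<in> L2_space"
  shows "ennreal ((cmod (LINT x|lebesgue. u x * v x))\<^sup>2) \<le> L2_energy u * L2_energy v"
proof -
  have "ennreal (cmod (LINT x|lebesgue. u x * v x)) \<le> (\<integral>\<^sup>+ x. ennreal (cmod (u x * v x)) \<partial>lebesgue)"
    by (rule integral_norm_bound_ennreal[OF integrable_L2_mult[OF assms]])
  then have "(ennreal (cmod (LINT x|lebesgue. u x * v x)))\<^sup>2 \<le> (\<integral>\<^sup>+ x. ennreal (cmod (u x * v x)) \<partial>lebesgue)\<^sup>2"
    by (rule power_mono) simp
  also have "\<dots> \<le> L2_energy u * L2_energy v"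
    using assms by (intro nn_integral_L2_mult_le) (auto simp: L2_space_iff_energy)
  finally show ?thesis by (simp add: ennreal_power)
qed

lemma integral_L2_mult_tendsto_0:
  assumes "\<And>n. a n \<in> L2_space" "\<And>n. b n \<in> L2_space"
    and "(\<lambda>n. L2_energy (a n) * L2_energy (b n)) \<longlonglongrightarrow> 0"
  shows "(\<lambda>n. LINT x|lebesgue. a n x * b n x) \<longlonglongrightarrow> 0"
proof -
  have "(\<lambda>n. ennreal ((cmod (LINT x|lebesgue. a n x * b n x))\<^sup>2)) \<longlonglongrightarrow> ennreal 0"
  proof (rule tendsto_sandwich[OF _ _ tendsto_const])
    show "(\<lambda>n. L2_energy (a n) * L2_energy (b n)) \<longlonglongrightarrow> ennreal 0" using assms(3) by simp
    show "\<forall>\<^sub>F n in sequentially. ennreal ((cmod (LINT x|lebesgue. a n x * b n x))\<^sup>2) \<le> L2_energy (a n) * L2_energy (b n)"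
      by (intro always_eventually allI norm_integral_L2_mult_le assms)
  qed simp
  then have "(\<lambda>n. (cmod (LINT x|lebesgue. a n x * b n x))\<^sup>2) \<longlonglongrightarrow> 0"
    by (subst (asm) tendsto_ennreal_iff) auto
  then have "(\<lambda>n. sqrt ((cmod (LINT x|lebesgue. a n x * b n x))\<^sup>2)) \<longlonglongrightarrow> sqrt 0"
    by (rule tendsto_real_sqrt)
  then show ?thesis by (simp add: tendsto_norm_zero_iff)
qed

lemma integral_L2_mult_tendsto:
  assumes f: "\<And>n. f n \<in> L2_space" "u \<in> L2_space" "L2_tendsto f u"
    and g: "\<And>n. g n \<in> L2_space" "v \<in> L2_space" "L2_tendsto g v"
  shows "(\<lambda>n. LINT x|lebesgue. f n x * g n x) \<longlonglongrightarrow> (LINT x|lebesgue. u x * v x)"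
proof -
  note dfu = L2_space_diff[OF f(1) f(2)] and dgv = L2_space_diff[OF g(1) g(2)]
  have fin: "L2_energy u \<noteq> top" "L2_energy v \<noteq> top" using f g by (auto simp: L2_space_iff_energy)
  have 1: "(\<lambda>n. LINT x|lebesgue. (f n x - u x) * (g n x - v x)) \<longlonglongrightarrow> 0"
    using tendsto_mult_ennreal[OF f(3)[unfolded L2_tendsto_iff_energy] g(3)[unfolded L2_tendsto_iff_energy]]
    by (intro integral_L2_mult_tendsto_0 dfu dgv) simp
  have 2: "(\<lambda>n. LINT x|lebesgue. (f n x - u x) * v x) \<longlonglongrightarrow> 0"
    using tendsto_mult_ennreal[OF f(3)[unfolded L2_tendsto_iff_energy] tendsto_const[of "L2_energy v"]] fin
    by (intro integral_L2_mult_tendsto_0 dfu g) simp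
  have 3: "(\<lambda>n. LINT x|lebesgue. u x * (g n x - v x)) \<longlonglongrightarrow> 0"
    using tendsto_mult_ennreal[OF tendsto_const[of "L2_energy u"] g(3)[unfolded L2_tendsto_iff_energy]] fin
    by (intro integral_L2_mult_tendsto_0 dgv f) simp
  have eq: "(LINT x|lebesgue. f n x * g n x) =
     (LINT x|lebesgue. (f n x - u x) * (g n x - v x)) + (LINT x|lebesgue. (f n x - u x) * v x)
     + (LINT x|lebesgue. u x * (g n x - v x)) + (LINT x|lebesgue. u x * v x)" for n
  proof -
    note I = integrable_L2_mult[OF dfu[of n] dgv[of n]] integrable_L2_mult[OF dfu[of n] g(2)]
      integrable_L2_mult[OF f(2) dgv[of n]] integrable_L2_mult[OF f(2) g(2)]
    have "(LINT x|lebesgue. f n x * g n x) = (LINT x|lebesgue. (f n x - u x) * (g n x - v x)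
       + (f n x - u x) * v x + u x * (g n x - v x) + u x * v x)"
      by (intro Bochner_Integration.integral_cong refl) (simp add: algebra_simps)
    then show ?thesis
      by (simp only: Bochner_Integration.integral_add Bochner_Integration.integrable_add I)
  qed
  show ?thesis unfolding eq
    using tendsto_add[OF tendsto_add[OF tendsto_add[OF 1 2] 3] tendsto_const] by simp
qed

lemma L2_tendsto_multiplier:
  fixes m :: "nat \<Rightarrow> real ^ 'n \<Rightarrow> complex"
  assumes u: "u \<in> L2_space" and [measurable]: "\<And>n. m n \<in> borel_measurable lebesgue"
    and m1: "\<And>n x. cmod (m n x) \<le> 1" and lim: "\<And>x. (\<lambda>n. m n x) \<longlonglongrightarrow> 1"
  shows "L2_tendsto (\<lambda>n x. m n x * u x) u"
proof -
  have [measurable]: "u \<in> borel_measurable lebesgue" using u by (auto simp: L2_space_iff_energy)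
  have "(\<lambda>n. \<integral>\<^sup>+ x. ennreal ((cmod (m n x * u x - u x))\<^sup>2) \<partial>lebesgue) \<longlonglongrightarrow> (\<integral>\<^sup>+ x. 0 \<partial>(lebesgue :: (real^'n) measure))"
  proof (rule nn_integral_dominated_convergence[where w = "\<lambda>x. 4 * ennreal ((cmod (u x))\<^sup>2)"])
    show "(\<integral>\<^sup>+ x. 4 * ennreal ((cmod (u x))\<^sup>2) \<partial>lebesgue) < \<infinity>"
      using u by (simp add: nn_integral_cmult L2_space_iff_energy L2_energy_def ennreal_mult_less_top)
    show "AE x in lebesgue. ennreal ((cmod (m n x * u x - u x))\<^sup>2) \<le> 4 * ennreal ((cmod (u x))\<^sup>2)" for n
    proof (rule AE_I2)
      fix x
      have "cmod (m n x - 1) \<le> 2" using norm_triangle_ineq4[of "m n x" 1] m1[of n x] by simp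
      then have "(cmod (m n x - 1))\<^sup>2 \<le> 2\<^sup>2" by (intro power_mono) auto
      then have "(cmod (m n x - 1))\<^sup>2 * (cmod (u x))\<^sup>2 \<le> 4 * (cmod (u x))\<^sup>2"
        by (intro mult_right_mono) auto
      moreover have "m n x * u x - u x = (m n x - 1) * u x" by (simp add: algebra_simps)
      ultimately have "(cmod (m n x * u x - u x))\<^sup>2 \<le> 4 * (cmod (u x))\<^sup>2"
        by (simp add: norm_mult power_mult_distrib)
      then show "ennreal ((cmod (m n x * u x - u x))\<^sup>2) \<le> 4 * ennreal ((cmod (u x))\<^sup>2)"
        by (simp flip: ennreal_mult'' ennreal_numeral add: ennreal_leI)
    qed
    show "AE x in lebesgue. (\<lambda>n. ennreal ((cmod (m n x * u x - u x))\<^sup>2)) \<longlonglongrightarrow> 0"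
    proof (rule AE_I2)
      fix x
      have "(\<lambda>n. (cmod (m n x * u x - u x))\<^sup>2) \<longlonglongrightarrow> (cmod (1 * u x - u x))\<^sup>2"
        by (intro tendsto_intros lim)
      then show "(\<lambda>n. ennreal ((cmod (m n x * u x - u x))\<^sup>2)) \<longlonglongrightarrow> 0"
        using tendsto_ennrealI by fastforce
    qed
  qed measurable
  then show ?thesis by (simp add: L2_tendsto_def)
qed

lemma indicator_cball_L2: "(indicator (cball a r) :: real ^ 'n \<Rightarrow> complex) \<in> L2_space"
proof -
  have "L2_energy (indicator (cball a r)) = (\<integral>\<^sup>+ x. indicator (cball a r) x \<partial>lebesgue)"
    unfolding L2_energy_def by (rule nn_integral_cong) (simp split: split_indicator)
  also have "\<dots> = emeasure lebesgue (cball a r)"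
    by (rule nn_integral_indicator) (simp add: lmeasurable_cball fmeasurableD)
  also have "\<dots> < \<infinity>"
    using lmeasurable_cball[of a r] by (simp add: fmeasurable_def)
  finally show ?thesis
    unfolding L2_space_iff_energy
    by (intro conjI borel_measurable_indicator) (simp_all add: lmeasurable_cball fmeasurableD)
qed

lemma L1_L2_dense:
  fixes u :: "real ^ 'n \<Rightarrow> complex"
  assumes u: "u \<in> L2_space"
  obtains f where "\<And>n. f n \<in> L1_space \<inter> L2_space" "L2_tendsto f u"
proof -
  let ?m = "\<lambda>n (x :: real ^ 'n). indicator (cball 0 (real n)) x :: complex"
  have meas: "?m n \<in> borel_measurable lebesgue" for n
    by (rule L2_space_measurable[OF indicator_cball_L2])
  have L2: "(\<lambda>x. ?m n x * u x) \<in> L2_space" for n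
    by (rule L2_space_mult[OF u meas, of _ 1]) (simp add: indicator_def)
  have L1: "(\<lambda>x. ?m n x * u x) \<in> L1_space" for n
    unfolding L1_space_def using integrable_L2_mult[OF indicator_cball_L2 u] by simp
  have "(\<lambda>n. ?m n x) \<longlonglongrightarrow> 1" for x :: "real ^ 'n"
  proof (rule tendsto_eventually)
    obtain k where "norm x \<le> real k" using real_arch_simple by blast
    then show "\<forall>\<^sub>F n in sequentially. ?m n x = 1"
      by (intro eventually_sequentiallyI[of k]) (auto simp: indicator_def)
  qed
  then have "L2_tendsto (\<lambda>n x. ?m n x * u x) u"
    by (intro L2_tendsto_multiplier u meas) (auto simp: indicator_def)
  then show thesis using that[of "\<lambda>n x. ?m n x * u x"] L1 L2 by blast
qed

text \<open>
  The Riesz--Fischer theorem.  Along a rapidly converging subsequence the differences \<open>d k\<close> satisfy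
  \<open>\<Sum>k. 2 ^ k * |d k x|\<^sup>2 < \<infinity>\<close> for almost every \<open>x\<close>, which forces geometric decay of \<open>|d k x|\<close>
  and hence pointwise convergence; Fatou's lemma transfers the Cauchy bounds to the limit.
\<close>

lemma L2_complete:
  fixes f :: "nat \<Rightarrow> real ^ 'n \<Rightarrow> complex"
  assumes f: "\<And>n. f n \<in> L2_space"
    and cauchy: "\<And>e. 0 < e \<Longrightarrow> \<exists>N. \<forall>m\<ge>N. \<forall>n\<ge>N. L2_energy (\<lambda>x. f m x - f n x) \<le> ennreal e"
  obtains g where "g \<in> L2_space" "L2_tendsto f g"
proof -
  have [measurable]: "f n \<in> borel_measurable lebesgue" for n
    using f by (auto simp: L2_space_iff_energy)
  obtain N where N: "\<And>k m n. m \<ge> N k \<Longrightarrow> n \<ge> N k \<Longrightarrow> L2_energy (\<lambda>x. f m x - f n x) \<le> ennreal ((1/4) ^ k)"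
    using cauchy[of "(1/4) ^ k" for k] by (metis zero_less_divide_1_iff zero_less_numeral zero_less_power)
  define r where "r k = (\<Sum>j\<le>k. N j) + k" for k
  have r: "r k \<ge> N k" "r (Suc k) \<ge> r k" "r k \<ge> k" for k
    by (auto simp: r_def intro: order_trans[OF _ le_add1] member_le_sum)
  define d where "d k x = f (r (Suc k)) x - f (r k) x" for k x
  have [measurable]: "d k \<in> borel_measurable lebesgue" for k unfolding d_def by measurable
  have "L2_energy (d k) \<le> ennreal ((1/4) ^ k)" for k
    unfolding d_def using r(1)[of k] r(2)[of k] by (intro N) auto
  then have dE: "(\<integral>\<^sup>+ x. ennreal (2 ^ k * (cmod (d k x))\<^sup>2) \<partial>lebesgue) \<le> ennreal ((1/2) ^ k)" for k
  proof -
    have "(\<integral>\<^sup>+ x. ennreal (2 ^ k * (cmod (d k x))\<^sup>2) \<partial>lebesgue) = ennreal (2 ^ k) * L2_energy (d k)"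
      unfolding L2_energy_def by (simp add: ennreal_mult nn_integral_cmult)
    also have "\<dots> \<le> ennreal (2 ^ k) * ennreal ((1/4) ^ k)"
      by (intro mult_left_mono \<open>L2_energy (d k) \<le> _\<close>) simp
    also have "\<dots> = ennreal ((1/2) ^ k)"
      by (simp flip: ennreal_mult power_mult_distrib)
    finally show ?thesis .
  qed
  have "(\<integral>\<^sup>+ x. (\<Sum>k. ennreal (2 ^ k * (cmod (d k x))\<^sup>2)) \<partial>lebesgue)
      = (\<Sum>k. \<integral>\<^sup>+ x. ennreal (2 ^ k * (cmod (d k x))\<^sup>2) \<partial>lebesgue)"
    by (rule nn_integral_suminf) measurable
  also have "\<dots> \<le> (\<Sum>k. ennreal ((1/2) ^ k))"
    by (intro suminf_le dE) auto
  also have "\<dots> = ennreal (\<Sum>k. (1/2) ^ k)"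
    by (intro suminf_ennreal2) (auto intro: summable_geometric)
  finally have "(\<integral>\<^sup>+ x. (\<Sum>k. ennreal (2 ^ k * (cmod (d k x))\<^sup>2)) \<partial>lebesgue) \<noteq> \<infinity>"
    unfolding infinity_ennreal_def by (rule neq_top_trans[OF ennreal_neq_top])
  then have "AE x in lebesgue. (\<Sum>k. ennreal (2 ^ k * (cmod (d k x))\<^sup>2)) \<noteq> \<infinity>"
    by (intro nn_integral_PInf_AE) measurable
  then have conv: "AE x in lebesgue. convergent (\<lambda>k. f (r k) x)"
  proof eventually_elim
    case (elim x)
    obtain C where C: "(\<Sum>k. ennreal (2 ^ k * (cmod (d k x))\<^sup>2)) = ennreal C" "0 \<le> C"
    proof (cases "\<Sum>k. ennreal (2 ^ k * (cmod (d k x))\<^sup>2)" rule: ennreal_cases)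
      case (real C)
      then show thesis by (intro that)
    next
      case top
      then show thesis using elim unfolding infinity_ennreal_def by (rule notE[rotated])
    qed
    have dk: "cmod (d k x) \<le> sqrt C * (sqrt (1/2)) ^ k" for k
    proof -
      have "(\<Sum>k\<in>{k}. ennreal (2 ^ k * (cmod (d k x))\<^sup>2)) \<le> (\<Sum>k. ennreal (2 ^ k * (cmod (d k x))\<^sup>2))"
        by (rule sum_le_suminf) auto
      then have "ennreal (2 ^ k * (cmod (d k x))\<^sup>2) \<le> ennreal C"
        unfolding C(1) by (simp only: sum.insert[OF finite.emptyI] sum.empty empty_iff not_False_eq_True add_0_right)
      then have "2 ^ k * (cmod (d k x))\<^sup>2 \<le> C"
        by (rule ennreal_le_iff[OF C(2), THEN iffD1])
      then have "(cmod (d k x))\<^sup>2 \<le> C * (1/2) ^ k" by (simp add: field_simps power_one_over)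
      then have "sqrt ((cmod (d k x))\<^sup>2) \<le> sqrt (C * (1/2) ^ k)" by (rule real_sqrt_le_mono)
      then show ?thesis by (simp add: real_sqrt_mult real_sqrt_power)
    qed
    have "summable (\<lambda>k. sqrt C * (sqrt (1/2)) ^ k)"
      by (intro summable_mult summable_geometric) (auto simp: real_sqrt_lt_1_iff)
    then have "summable (\<lambda>k. d k x)"
      by (rule summable_comparison_test') (rule dk)
    then have "convergent (\<lambda>n. \<Sum>k<n. d k x)" unfolding summable_iff_convergent .
    moreover have "(\<Sum>k<n. d k x) = f (r n) x - f (r 0) x" for n
      unfolding d_def by (rule sum_lessThan_telescope)
    ultimately have "convergent (\<lambda>n. f (r n) x - f (r 0) x)" by (simp only:)
    from convergent_add[OF this convergent_const[of "f (r 0) x"]] show ?case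
      by (simp only: diff_add_cancel)
  qed
  define g where "g x = lim (\<lambda>k. f (r k) x)" for x
  have [measurable]: "g \<in> borel_measurable lebesgue"
    unfolding g_def[abs_def] by (rule borel_measurable_lim_metric) measurable
  have lim: "AE x in lebesgue. (\<lambda>k. f (r k) x) \<longlonglongrightarrow> g x"
    using conv by eventually_elim (simp add: g_def convergent_LIMSEQ_iff)
  have bound: "L2_energy (\<lambda>x. f m x - g x) \<le> ennreal e"
    if "\<And>n. n \<ge> K \<Longrightarrow> L2_energy (\<lambda>x. f m x - f n x) \<le> ennreal e" for m K e
  proof -
    have "L2_energy (\<lambda>x. f m x - g x) = (\<integral>\<^sup>+ x. liminf (\<lambda>k. ennreal ((cmod (f m x - f (r k) x))\<^sup>2)) \<partial>lebesgue)"
      unfolding L2_energy_def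
    proof (rule nn_integral_cong_AE, use lim in eventually_elim)
      case (elim x)
      have "(\<lambda>k. ennreal ((cmod (f m x - f (r k) x))\<^sup>2)) \<longlonglongrightarrow> ennreal ((cmod (f m x - g x))\<^sup>2)"
        by (intro tendsto_intros elim)
      then show ?case by (intro lim_imp_Liminf[symmetric]) simp_all
    qed
    also have "\<dots> \<le> liminf (\<lambda>k. \<integral>\<^sup>+ x. ennreal ((cmod (f m x - f (r k) x))\<^sup>2) \<partial>lebesgue)"
      by (rule nn_integral_liminf) measurable
    also have "\<dots> \<le> ennreal e"
    proof (rule Liminf_le)
      show "\<forall>\<^sub>F k in sequentially. (\<integral>\<^sup>+ x. ennreal ((cmod (f m x - f (r k) x))\<^sup>2) \<partial>lebesgue) \<le> ennreal e"
        by (intro eventually_sequentiallyI[of K] that[unfolded L2_energy_def]) (rule order_trans[OF _ r(3)])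
    qed simp
    finally show ?thesis .
  qed
  have tend: "L2_tendsto f g"
    unfolding L2_tendsto_iff_energy
  proof (rule tendsto_zero_ennreal)
    fix e :: real assume "0 < e"
    then obtain K where "\<forall>m\<ge>K. \<forall>n\<ge>K. L2_energy (\<lambda>x. f m x - f n x) \<le> ennreal (e / 2)"
      using cauchy[of "e / 2"] by auto
    then have "L2_energy (\<lambda>x. f m x - g x) \<le> ennreal (e / 2)" if "m \<ge> K" for m
      using that by (intro bound[of K]) auto
    moreover have "ennreal (e / 2) < ennreal e" using \<open>0 < e\<close> by (simp add: ennreal_lessI)
    ultimately show "\<forall>\<^sub>F m in sequentially. L2_energy (\<lambda>x. f m x - g x) < ennreal e"
      by (intro eventually_sequentiallyI[of K]) (rule le_less_trans)
  qed
  obtain K where "\<forall>m\<ge>K. \<forall>n\<ge>K. L2_energy (\<lambda>x. f m x - f n x) \<le> ennreal 1"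
    using cauchy[of 1] by auto
  then have "L2_energy (\<lambda>x. f K x - g x) \<le> ennreal 1"
    by (intro bound[of K]) auto
  then have "(\<lambda>x. f K x - g x) \<in> L2_space"
    by (auto simp: L2_space_iff_energy intro: le_less_trans)
  from L2_space_diff[OF f[of K] this] have "g \<in> L2_space" by simp
  then show thesis using that tend by blast
qed

section \<open>Convolution\<close>

lemma nn_integral_lborel_affine:
  fixes t :: "'a::euclidean_space"
  assumes [measurable]: "f \<in> borel_measurable borel" and "c \<noteq> 0"
  shows "(\<integral>\<^sup>+ x. f x \<partial>lborel) = ennreal (\<bar>c\<bar> ^ DIM('a)) * (\<integral>\<^sup>+ x. f (t + c *\<^sub>R x) \<partial>lborel)"
  by (subst lborel_affine[OF \<open>c \<noteq> 0\<close>, of t])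
     (simp add: nn_integral_density nn_integral_distr nn_integral_cmult)

lemma nn_integral_lborel_reflect:
  fixes t :: "'a::euclidean_space"
  assumes "f \<in> borel_measurable borel"
  shows "(\<integral>\<^sup>+ x. f (t - x) \<partial>lborel) = (\<integral>\<^sup>+ x. f x \<partial>lborel)"
  using nn_integral_lborel_affine[OF assms, of "-1" t] by simp

lemma nn_integral_lborel_translate:
  fixes t :: "'a::euclidean_space"
  assumes "f \<in> borel_measurable borel"
  shows "(\<integral>\<^sup>+ x. f (x - t) \<partial>lborel) = (\<integral>\<^sup>+ x. f x \<partial>lborel)"
  using nn_integral_lborel_affine[OF assms, of 1 "-t"] by simp

lemma integral_lborel_affine:
  fixes t :: "'a::euclidean_space" and f :: "'a \<Rightarrow> 'b::{banach, second_countable_topology}"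
  assumes [measurable]: "f \<in> borel_measurable borel" and "c \<noteq> 0"
  shows "(LINT x|lborel. f x) = \<bar>c\<bar> ^ DIM('a) *\<^sub>R (LINT x|lborel. f (t + c *\<^sub>R x))"
  by (subst lborel_affine[OF \<open>c \<noteq> 0\<close>, of t]) (simp add: integral_density integral_distr)

lemma AE_lebesgue_reflect:
  fixes t :: "'a::euclidean_space"
  assumes "AE x in lebesgue. P x"
  shows "AE x in lebesgue. P (t - x)"
proof -
  have "AE x in lborel. P x" using assms by (simp add: AE_completion_iff)
  then obtain N where N: "{x. \<not> P x} \<subseteq> N" "N \<in> null_sets lborel"
    unfolding eventually_ae_filter by auto
  have [measurable]: "N \<in> sets borel" using N by auto
  have "(\<integral>\<^sup>+ x. indicator N (t - x) \<partial>lborel) = emeasure lborel N"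
    by (subst nn_integral_lborel_reflect) auto
  also have "\<dots> = 0" using N by auto
  finally have "AE x in lborel. (indicator N (t - x) :: ennreal) = 0"
    by (subst (asm) nn_integral_0_iff_AE) auto
  then have "AE x in lborel. P (t - x)"
    by eventually_elim (use N in \<open>auto simp: indicator_def split: if_splits\<close>)
  then show ?thesis by (rule AE_completion)
qed

lemma reflect_measurable_lebesgue:
  fixes f :: "'a::euclidean_space \<Rightarrow> 'b::euclidean_space"
  assumes "f \<in> borel_measurable lebesgue"
  shows "(\<lambda>x. f (t - x)) \<in> borel_measurable lebesgue"
  using borel_measurable_affine[OF assms, of "-1" t] by simp

lemma convolution_integrand_cong_AE:
  fixes G G' u u' :: "real ^ 'n \<Rightarrow> complex"
  assumes "AE x in lebesgue. G x = G' x" "AE x in lebesgue. u x = u' x"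
  shows "AE y in lebesgue. G (x - y) * u y = G' (x - y) * u' y"
  using AE_lebesgue_reflect[OF assms(1), of x] assms(2) by eventually_elim simp

lemma convolution_cong_AE:
  fixes G G' u u' :: "real ^ 'n \<Rightarrow> complex"
  assumes "AE x in lebesgue. G x = G' x" "AE x in lebesgue. u x = u' x"
    and "G \<in> borel_measurable lebesgue" "G' \<in> borel_measurable lebesgue"
    and "u \<in> borel_measurable lebesgue" "u' \<in> borel_measurable lebesgue"
  shows "convolution G u = convolution G' u'"
  unfolding convolution_def
  by (intro ext integral_cong_AE borel_measurable_times reflect_measurable_lebesgue
      convolution_integrand_cong_AE assms)

text \<open>
  Young's inequality in terms of extended nonnegative integrals, so that it also yields absolute
  convergence of the convolution integral almost everywhere.
\<close>

lemma nn_integral_convolution_le: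
  fixes g v :: "real ^ 'n \<Rightarrow> complex"
  assumes [measurable]: "g \<in> borel_measurable borel" "v \<in> borel_measurable borel"
  defines "A \<equiv> (\<integral>\<^sup>+ x. ennreal (cmod (g x)) \<partial>lborel)"
  shows "(\<integral>\<^sup>+ x. (\<integral>\<^sup>+ y. ennreal (cmod (g (x - y) * v y)) \<partial>lborel)\<^sup>2 \<partial>lborel)
      \<le> A\<^sup>2 * (\<integral>\<^sup>+ x. ennreal ((cmod (v x))\<^sup>2) \<partial>lborel)"
proof -
  \<comment> \<open>Cauchy--Schwarz for the splitting of \<open>|g (x - y)|\<close> into two square roots.\<close>
  have "(\<integral>\<^sup>+ y. ennreal (cmod (g (x - y) * v y)) \<partial>lborel)\<^sup>2
      \<le> A * (\<integral>\<^sup>+ y. ennreal (cmod (g (x - y)) * (cmod (v y))\<^sup>2) \<partial>lborel)" for x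
  proof -
    have "ennreal (cmod (g (x - y) * v y)) =
        ennreal (sqrt (cmod (g (x - y)))) * ennreal (sqrt (cmod (g (x - y))) * cmod (v y))" for y
      by (simp add: norm_mult mult.assoc[symmetric] flip: ennreal_mult)
    then have "(\<integral>\<^sup>+ y. ennreal (cmod (g (x - y) * v y)) \<partial>lborel)\<^sup>2
      \<le> (\<integral>\<^sup>+ y. (ennreal (sqrt (cmod (g (x - y)))))\<^sup>2 \<partial>lborel)
        * (\<integral>\<^sup>+ y. (ennreal (sqrt (cmod (g (x - y))) * cmod (v y)))\<^sup>2 \<partial>lborel)"
      by (simp only:) (rule Cauchy_Schwarz_nn_integral; measurable)
    also have "(\<integral>\<^sup>+ y. (ennreal (sqrt (cmod (g (x - y)))))\<^sup>2 \<partial>lborel) = A"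
      unfolding A_def by (subst nn_integral_lborel_reflect[symmetric, of _ x]) (auto simp: ennreal_power)
    finally show ?thesis by (simp add: ennreal_power power_mult_distrib)
  qed
  then have "(\<integral>\<^sup>+ x. (\<integral>\<^sup>+ y. ennreal (cmod (g (x - y) * v y)) \<partial>lborel)\<^sup>2 \<partial>lborel)
      \<le> (\<integral>\<^sup>+ x. A * (\<integral>\<^sup>+ y. ennreal (cmod (g (x - y)) * (cmod (v y))\<^sup>2) \<partial>lborel) \<partial>lborel)"
    by (intro nn_integral_mono)
  also have "\<dots> = A * (\<integral>\<^sup>+ x. \<integral>\<^sup>+ y. ennreal (cmod (g (x - y)) * (cmod (v y))\<^sup>2) \<partial>lborel \<partial>lborel)"
    by (rule nn_integral_cmult) measurable
  also have "(\<integral>\<^sup>+ x. \<integral>\<^sup>+ y. ennreal (cmod (g (x - y)) * (cmod (v y))\<^sup>2) \<partial>lborel \<partial>lborel)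
      = (\<integral>\<^sup>+ y. \<integral>\<^sup>+ x. ennreal (cmod (g (x - y)) * (cmod (v y))\<^sup>2) \<partial>lborel \<partial>lborel)"
    by (rule lborel_pair.Fubini'[symmetric]) measurable
  also have "\<dots> = (\<integral>\<^sup>+ y. A * ennreal ((cmod (v y))\<^sup>2) \<partial>lborel)"
  proof (rule nn_integral_cong)
    fix y
    have "(\<integral>\<^sup>+ x. ennreal (cmod (g (x - y)) * (cmod (v y))\<^sup>2) \<partial>lborel)
        = (\<integral>\<^sup>+ x. ennreal (cmod (g (x - y))) \<partial>lborel) * ennreal ((cmod (v y))\<^sup>2)"
      by (simp add: ennreal_mult nn_integral_multc)
    then show "(\<integral>\<^sup>+ x. ennreal (cmod (g (x - y)) * (cmod (v y))\<^sup>2) \<partial>lborel) = A * ennreal ((cmod (v y))\<^sup>2)"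
      unfolding A_def by (subst (asm) nn_integral_lborel_translate) auto
  qed
  also have "\<dots> = A * (\<integral>\<^sup>+ x. ennreal ((cmod (v x))\<^sup>2) \<partial>lborel)"
    by (rule nn_integral_cmult) measurable
  finally show ?thesis by (simp add: power2_eq_square mult_ac)
qed

lemma convolution_borel:
  assumes [measurable]: "g \<in> borel_measurable borel" "v \<in> borel_measurable borel"
  shows "convolution g v x = (LINT y|lborel. g (x - y) * v y)"
  unfolding convolution_def by (intro integral_completion) measurable

lemma
  fixes G u :: "real ^ 'n \<Rightarrow> complex"
  assumes G: "integrable lebesgue G" and u: "u \<in> L2_space"
  shows AE_integrable_convolution: "AE x in lebesgue. integrable lebesgue (\<lambda>y. G (x - y) * u y)"
    and convolution_L2: "convolution G u \<in> L2_space"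
    and L2_energy_convolution_le:
      "L2_energy (convolution G u) \<le> (\<integral>\<^sup>+ x. ennreal (cmod (G x)) \<partial>lebesgue)\<^sup>2 * L2_energy u"
proof -
  obtain g where g: "integrable lborel g" "g \<in> borel_measurable borel" "AE x in lebesgue. G x = g x"
    using integrable_eq_borel_AE[OF G] .
  obtain v where v: "v \<in> borel_measurable borel" "AE x in lebesgue. u x = v x"
    using lebesgue_measurable_eq_borel_AE[OF L2_space_measurable[OF u]] .
  note [measurable] = g(2) v(1)
  note leb = borel_measurable_integrable[OF G] borel_imp_lebesgue_measurable[OF g(2)]
    L2_space_measurable[OF u] borel_imp_lebesgue_measurable[OF v(1)]
  define h where "h x = (\<integral>\<^sup>+ y. ennreal (cmod (g (x - y) * v y)) \<partial>lborel)" for x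
  have [measurable]: "h \<in> borel_measurable borel"
    unfolding h_def[abs_def] by measurable
  have A: "(\<integral>\<^sup>+ x. ennreal (cmod (G x)) \<partial>lebesgue) = (\<integral>\<^sup>+ x. ennreal (cmod (g x)) \<partial>lborel)"
  proof -
    have "(\<integral>\<^sup>+ x. ennreal (cmod (G x)) \<partial>lebesgue) = (\<integral>\<^sup>+ x. ennreal (cmod (g x)) \<partial>lebesgue)"
      by (rule nn_integral_cong_AE) (use g(3) in eventually_elim, simp)
    then show ?thesis by (simp add: nn_integral_completion)
  qed
  have E: "L2_energy u = (\<integral>\<^sup>+ x. ennreal ((cmod (v x))\<^sup>2) \<partial>lborel)"
    unfolding L2_energy_cong_AE[OF v(2)] by (simp add: L2_energy_def nn_integral_completion)
  have h2: "(\<integral>\<^sup>+ x. (h x)\<^sup>2 \<partial>lborel) \<le> (\<integral>\<^sup>+ x. ennreal (cmod (G x)) \<partial>lebesgue)\<^sup>2 * L2_energy u"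
    unfolding A E h_def by (rule nn_integral_convolution_le) measurable
  also have "\<dots> < \<infinity>"
    using u G by (auto simp: ennreal_mult_less_top L2_space_iff_energy integrable_iff_bounded power2_eq_square)
  finally have "AE x in lborel. (h x)\<^sup>2 \<noteq> \<infinity>"
    by (intro nn_integral_PInf_AE) auto
  then have hfin: "AE x in lborel. h x < \<infinity>"
    by eventually_elim (auto simp: power2_eq_square ennreal_mult_eq_top_iff top.not_eq_extremum)
  have "AE x in lebesgue. integrable lborel (\<lambda>y. g (x - y) * v y)"
    by (intro AE_completion) (use hfin in eventually_elim, auto simp: h_def integrable_iff_bounded)
  then show "AE x in lebesgue. integrable lebesgue (\<lambda>y. G (x - y) * u y)"
  proof eventually_elim
    case (elim x)
    then have "integrable lebesgue (\<lambda>y. g (x - y) * v y)"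
      by (subst integrable_completion) auto
    moreover have "(\<lambda>y. G (x - y) * u y) \<in> borel_measurable lebesgue"
      by (intro borel_measurable_times reflect_measurable_lebesgue leb)
    ultimately show ?case
      by (rule integrable_cong_AE_imp)
         (use convolution_integrand_cong_AE[OF g(3) v(2), of x] in eventually_elim, simp)
  qed
  have conv: "convolution G u = convolution g v"
    by (intro convolution_cong_AE g v leb)
  have [measurable]: "convolution g v \<in> borel_measurable borel"
    unfolding convolution_borel[OF g(2) v(1), abs_def] by measurable
  have "ennreal (cmod (convolution g v x)) \<le> h x" for x
  proof (cases "integrable lborel (\<lambda>y. g (x - y) * v y)")
    case True
    then show ?thesis unfolding convolution_borel[OF g(2) v(1)] h_def by (rule integral_norm_bound_ennreal)
  qed (simp add: convolution_borel not_integrable_integral_eq g v)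
  then have "L2_energy (convolution g v) \<le> (\<integral>\<^sup>+ x. (h x)\<^sup>2 \<partial>lebesgue)"
    unfolding L2_energy_def
    by (intro nn_integral_mono) (simp flip: ennreal_power add: power_mono)
  also have "\<dots> = (\<integral>\<^sup>+ x. (h x)\<^sup>2 \<partial>lborel)" by (rule nn_integral_completion)
  finally show le: "L2_energy (convolution G u) \<le> (\<integral>\<^sup>+ x. ennreal (cmod (G x)) \<partial>lebesgue)\<^sup>2 * L2_energy u"
    unfolding conv using h2 by (rule order_trans)
  show "convolution G u \<in> L2_space"
    using le \<open>_ < \<infinity>\<close> unfolding L2_space_iff_energy conv
    by (auto intro: borel_imp_lebesgue_measurable le_less_trans)
qed

lemma
  fixes G u :: "real ^ 'n \<Rightarrow> complex"
  assumes G: "integrable lebesgue G" and u: "integrable lebesgue u"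
  shows integrable_convolution: "integrable lebesgue (convolution G u)"
    and signed_fourier_convolution:
      "signed_fourier \<sigma> (convolution G u) \<xi> = signed_fourier \<sigma> G \<xi> * signed_fourier \<sigma> u \<xi>"
proof -
  obtain g where g: "integrable lborel g" "g \<in> borel_measurable borel" "AE x in lebesgue. G x = g x"
    using integrable_eq_borel_AE[OF G] .
  obtain v where v: "integrable lborel v" "v \<in> borel_measurable borel" "AE x in lebesgue. u x = v x"
    using integrable_eq_borel_AE[OF u] .
  note [measurable] = g(2) v(2)
  note leb = borel_measurable_integrable[OF G] borel_imp_lebesgue_measurable[OF g(2)]
    borel_measurable_integrable[OF u] borel_imp_lebesgue_measurable[OF v(2)]
  have conv: "convolution G u = convolution g v"
    by (intro convolution_cong_AE g v leb)
  have int: "integrable (lborel \<Otimes>\<^sub>M lborel) (\<lambda>(x, y). c x * (g (x - y) * v y))"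
    if [measurable]: "c \<in> borel_measurable borel" and c: "\<And>x. cmod (c x) \<le> 1" for c :: "real ^ 'n \<Rightarrow> complex"
  proof (rule integrableI_bounded)
    have "(\<integral>\<^sup>+ z. ennreal (norm (case z of (x, y) \<Rightarrow> c x * (g (x - y) * v y))) \<partial>(lborel \<Otimes>\<^sub>M lborel))
       \<le> (\<integral>\<^sup>+ z. ennreal (case z of (x, y) \<Rightarrow> cmod (g (x - y)) * cmod (v y)) \<partial>(lborel \<Otimes>\<^sub>M lborel))"
      using c by (intro nn_integral_mono) (auto simp: norm_mult intro!: ennreal_leI mult_left_le_one_le)
    also have "\<dots> = (\<integral>\<^sup>+ y. \<integral>\<^sup>+ x. ennreal (cmod (g (x - y)) * cmod (v y)) \<partial>lborel \<partial>lborel)"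
      by (subst lborel_pair.nn_integral_snd[symmetric]) auto
    also have "\<dots> = (\<integral>\<^sup>+ y. (\<integral>\<^sup>+ x. ennreal (cmod (g x)) \<partial>lborel) * ennreal (cmod (v y)) \<partial>lborel)"
    proof (rule nn_integral_cong)
      fix y
      have "(\<integral>\<^sup>+ x. ennreal (cmod (g (x - y)) * cmod (v y)) \<partial>lborel)
          = (\<integral>\<^sup>+ x. ennreal (cmod (g (x - y))) \<partial>lborel) * ennreal (cmod (v y))"
        by (simp add: ennreal_mult nn_integral_multc)
      then show "(\<integral>\<^sup>+ x. ennreal (cmod (g (x - y)) * cmod (v y)) \<partial>lborel)
          = (\<integral>\<^sup>+ x. ennreal (cmod (g x)) \<partial>lborel) * ennreal (cmod (v y))"
        by (subst (asm) nn_integral_lborel_translate) auto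
    qed
    also have "\<dots> = (\<integral>\<^sup>+ x. ennreal (cmod (g x)) \<partial>lborel) * (\<integral>\<^sup>+ y. ennreal (cmod (v y)) \<partial>lborel)"
      by (rule nn_integral_cmult) measurable
    also have "\<dots> < \<infinity>"
      using g(1) v(1) by (auto simp: integrable_iff_bounded ennreal_mult_less_top)
    finally show "(\<integral>\<^sup>+ z. ennreal (norm (case z of (x, y) \<Rightarrow> c x * (g (x - y) * v y))) \<partial>(lborel \<Otimes>\<^sub>M lborel)) < \<infinity>" .
  qed measurable
  have cb: "convolution g v x = (LINT y|lborel. g (x - y) * v y)" for x
    by (rule convolution_borel) measurable
  have [measurable]: "convolution g v \<in> borel_measurable borel"
    unfolding cb[abs_def] by measurable
  have "integrable lborel (convolution g v)"
    using lborel_pair.integrable_fst[OF int[of "\<lambda>_. 1"]] by (simp add: cb[abs_def])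
  then show "integrable lebesgue (convolution G u)"
    unfolding conv by (subst integrable_completion) auto
  define c where "c x = cis (2 * pi * \<sigma> * (\<xi> \<bullet> x))" for x
  have [measurable]: "c \<in> borel_measurable borel" unfolding c_def[abs_def] by measurable
  have "signed_fourier \<sigma> (convolution G u) \<xi> = (LINT x|lborel. LINT y|lborel. c x * (g (x - y) * v y))"
    unfolding conv by (subst signed_fourier_borel) (auto simp: c_def cb)
  also have "\<dots> = (LINT y|lborel. LINT x|lborel. c x * (g (x - y) * v y))"
    by (rule lborel_pair.Fubini_integral[symmetric], rule int) (auto simp: c_def)
  also have "\<dots> = (LINT y|lborel. signed_fourier \<sigma> g \<xi> * (c y * v y))"
  proof (rule Bochner_Integration.integral_cong[OF refl])
    fix y
    have "(LINT x|lborel. c x * (g (x - y) * v y)) = (LINT x|lborel. c (y + x) * (g x * v y))"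
      by (subst integral_lborel_affine[where c = 1 and t = y]) auto
    also have "(\<lambda>x. c (y + x) * (g x * v y)) = (\<lambda>x. (c x * g x) * (c y * v y))"
      by (simp add: c_def inner_add_right distrib_left fun_eq_iff flip: cis_mult)
    also have "(LINT x|lborel. (c x * g x) * (c y * v y)) = signed_fourier \<sigma> g \<xi> * (c y * v y)"
      by (simp add: signed_fourier_borel c_def)
    finally show "(LINT x|lborel. c x * (g (x - y) * v y)) = signed_fourier \<sigma> g \<xi> * (c y * v y)" .
  qed
  also have "\<dots> = signed_fourier \<sigma> g \<xi> * signed_fourier \<sigma> v \<xi>"
    by (simp add: signed_fourier_borel c_def)
  finally show "signed_fourier \<sigma> (convolution G u) \<xi> = signed_fourier \<sigma> G \<xi> * signed_fourier \<sigma> u \<xi>"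
    unfolding signed_fourier_cong_AE[OF leb(1,2) g(3)] signed_fourier_cong_AE[OF leb(3,4) v(3)] .
qed

section \<open>The contraction property on integrable, square integrable functions\<close>

text \<open>
  The Fourier transform of \<open>gaussian a\<close>: a probability density that concentrates at 0 as \<open>a\<close> tends
  to 0.  It is complex valued to serve directly as a convolution kernel.
\<close>

definition gauss_kernel :: "real \<Rightarrow> real ^ 'n \<Rightarrow> complex" where
  "gauss_kernel a x = of_real (gaussian (1 / a) x / sqrt a ^ CARD('n))"

lemma gauss_kernel_measurable [measurable]: "gauss_kernel a \<in> borel_measurable borel"
  unfolding gauss_kernel_def[abs_def] by measurable

lemma gauss_kernel_minus [simp]: "gauss_kernel a (- x) = gauss_kernel a x"
  by (simp add: gauss_kernel_def gaussian_def)

lemma gaussian_nonneg [simp]: "0 \<le> gaussian a x"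
  by (simp add: gaussian_def)

lemma gaussian_le_1: "0 \<le> a \<Longrightarrow> gaussian a x \<le> 1"
  by (simp add: gaussian_def)

lemma integrable_gaussian_lebesgue:
  assumes "0 < a"
  shows "integrable lebesgue (\<lambda>x::real^'n. complex_of_real (gaussian a x))"
  using integrable_gaussian[OF assms] by (subst integrable_completion) auto

lemma integrable_gauss_kernel:
  assumes "0 < a"
  shows "integrable lebesgue (gauss_kernel a :: real ^ 'n \<Rightarrow> complex)"
  unfolding gauss_kernel_def[abs_def] of_real_divide
  by (intro integrable_divide integrable_gaussian_lebesgue) (use assms in auto)

lemma signed_fourier_gaussian_kernel:
  assumes "0 < a" "\<bar>\<sigma>\<bar> = 1"
  shows "signed_fourier \<sigma> (\<lambda>x. of_real (gaussian a x)) = gauss_kernel a"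
  by (intro ext) (simp add: signed_fourier_gaussian assms gauss_kernel_def)

lemma integral_gaussian:
  assumes "0 < a"
  shows "(LINT x|lborel. gaussian a (x :: real ^ 'n)) = 1 / sqrt a ^ CARD('n)"
proof -
  have "complex_of_real (LINT x|lborel. gaussian a (x :: real ^ 'n)) = signed_fourier 1 (\<lambda>x. of_real (gaussian a x)) (0 :: real ^ 'n)"
    by (subst signed_fourier_borel) auto
  also have "\<dots> = of_real (1 / sqrt a ^ CARD('n))"
    using assms by (subst signed_fourier_gaussian) (simp_all add: gaussian_def)
  finally show ?thesis by (simp only: of_real_eq_iff)
qed

lemma nn_integral_gauss_kernel:
  assumes "0 < a"
  shows "(\<integral>\<^sup>+ x. ennreal (cmod (gauss_kernel a (x :: real ^ 'n))) \<partial>lebesgue) = 1"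
proof -
  have "(\<integral>\<^sup>+ x. ennreal (cmod (gauss_kernel a (x :: real ^ 'n))) \<partial>lebesgue)
      = (\<integral>\<^sup>+ x. ennreal (gaussian (1 / a) (x :: real ^ 'n) / sqrt a ^ CARD('n)) \<partial>lborel)"
    using assms by (simp add: nn_integral_completion gauss_kernel_def norm_divide norm_power)
  also have "\<dots> = ennreal (LINT x|lborel. gaussian (1 / a) (x :: real ^ 'n) / sqrt a ^ CARD('n))"
    using assms by (intro nn_integral_eq_integral integrable_divide integrable_gaussian) auto
  also have "\<dots> = 1"
    using assms by (simp add: integral_gaussian real_sqrt_divide power_divide)
  finally show ?thesis .
qed

text \<open>
  Multiplying the transform by a Gaussian and transforming back averages the function with a Gaussian
  kernel: apply the multiplication formula to \<open>f\<close> and the modulated Gaussian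
  \<open>h \<xi> = exp (-2 \<pi> i \<sigma> (x \<bullet> \<xi>)) * gaussian a \<xi>\<close>.
\<close>

lemma signed_fourier_gaussian_regularization:
  fixes f :: "real ^ 'n \<Rightarrow> complex"
  assumes f: "integrable lebesgue f" and a: "0 < a" and \<sigma>: "\<bar>\<sigma>\<bar> = 1"
  shows "signed_fourier (-\<sigma>) (\<lambda>\<xi>. of_real (gaussian a \<xi>) * signed_fourier \<sigma> f \<xi>) = convolution (gauss_kernel a) f"
proof
  fix x :: "real ^ 'n"
  define h where "h \<xi> = cis (- (2 * pi * \<sigma> * (x \<bullet> \<xi>))) * complex_of_real (gaussian a \<xi>)" for \<xi>
  have h: "integrable lebesgue h"
    using integrable_phase_mult[OF integrable_gaussian_lebesgue[OF a], of "- (2 * pi * \<sigma>)" x]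
    by (simp add: h_def[abs_def])
  have "signed_fourier (-\<sigma>) (\<lambda>\<xi>. of_real (gaussian a \<xi>) * signed_fourier \<sigma> f \<xi>) x
      = (LINT \<xi>|lebesgue. signed_fourier \<sigma> f \<xi> * h \<xi>)"
    unfolding signed_fourier_def[of "-\<sigma>"] h_def by (simp add: mult_ac)
  also have "\<dots> = (LINT y|lebesgue. f y * signed_fourier \<sigma> h y)"
    by (rule signed_fourier_multiplication[OF f h])
  also have "\<dots> = (LINT y|lebesgue. gauss_kernel a (x - y) * f y)"
  proof (rule Bochner_Integration.integral_cong[OF refl])
    fix y
    have "signed_fourier \<sigma> h y = gauss_kernel a (y - x)"
      unfolding h_def[abs_def] signed_fourier_modulation signed_fourier_gaussian_kernel[OF a \<sigma>] ..
    then show "f y * signed_fourier \<sigma> h y = gauss_kernel a (x - y) * f y"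
      using gauss_kernel_minus[of a "y - x"] by simp
  qed
  finally show "signed_fourier (-\<sigma>) (\<lambda>\<xi>. of_real (gaussian a \<xi>) * signed_fourier \<sigma> f \<xi>) x
      = convolution (gauss_kernel a) f x"
    unfolding convolution_def .
qed

lemma integrable_gaussian_fourier:
  fixes f :: "real ^ 'n \<Rightarrow> complex"
  assumes "integrable lebesgue f" and "0 < a"
  shows "integrable lebesgue (\<lambda>\<xi>. of_real (gaussian a \<xi>) * signed_fourier \<sigma> f \<xi>)"
  using integrable_signed_fourier_mult[OF assms(1) integrable_gaussian_lebesgue[OF assms(2)], of \<sigma>]
  by (simp add: mult.commute)

text \<open>
  The widths along which \<open>a\<close> tends to 0.  Squares are chosen so that \<open>gauss_kernel (approx_width n)\<close>
  is, up to normalization, \<open>gaussian 1\<close> with its argument scaled by \<open>Suc n\<close>.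
\<close>

definition approx_width :: "nat \<Rightarrow> real" where
  "approx_width n = 1 / (real (Suc n))\<^sup>2"

lemma approx_width_pos [simp]: "0 < approx_width n"
  by (simp add: approx_width_def)

lemma approx_width_tendsto: "approx_width \<longlonglongrightarrow> 0"
  unfolding approx_width_def[abs_def] by real_asymp

lemma gaussian_approx_tendsto: "(\<lambda>n. gaussian (approx_width n) x) \<longlonglongrightarrow> 1"
proof -
  have "(\<lambda>n. exp (- pi * approx_width n * (norm x)\<^sup>2)) \<longlonglongrightarrow> exp (- pi * 0 * (norm x)\<^sup>2)"
    by (intro tendsto_intros approx_width_tendsto)
  then show ?thesis by (simp add: gaussian_def)
qed

text \<open>
  By the regularization lemma, \<open>\<integral> gaussian a * |F f|\<^sup>2\<close> is the inner product of a Gaussian average of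
  \<open>f\<close> with \<open>f\<close>; Cauchy--Schwarz and Young's inequality bound it by the energy of \<open>f\<close>, uniformly in
  \<open>a\<close>, and \<open>a\<close> may tend to 0 by Fatou's lemma.  Equality is a case of \<open>fourier_value_parseval\<close>.
\<close>

lemma L2_energy_signed_fourier_le:
  fixes f :: "real ^ 'n \<Rightarrow> complex"
  assumes f: "f \<in> L1_space \<inter> L2_space" and \<sigma>: "\<bar>\<sigma>\<bar> = 1"
  shows "L2_energy (signed_fourier \<sigma> f) \<le> L2_energy f"
proof -
  have f1: "integrable lebesgue f" and f2: "f \<in> L2_space" using f by (auto simp: L1_space_def)
  have [measurable]: "signed_fourier \<sigma> f \<in> borel_measurable lebesgue"
    by (intro borel_imp_lebesgue_measurable signed_fourier_measurable f1)
  have [measurable]: "gaussian a \<in> borel_measurable lebesgue" for a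
    by (intro borel_imp_lebesgue_measurable gaussian_measurable)
  obtain e where e: "L2_energy f = ennreal e" "0 \<le> e"
    using f2 by (cases "L2_energy f" rule: ennreal_cases) (auto simp: L2_space_iff_energy)
  have bound: "(\<integral>\<^sup>+ \<xi>. ennreal (gaussian a \<xi> * (cmod (signed_fourier \<sigma> f \<xi>))\<^sup>2) \<partial>lebesgue) \<le> ennreal e"
    if a: "0 < a" for a
  proof -
    define I where "I = (LINT \<xi>|lebesgue. gaussian a \<xi> * (cmod (signed_fourier \<sigma> f \<xi>))\<^sup>2)"
    have sq: "(of_real (gaussian a \<xi>) * signed_fourier \<sigma> f \<xi>) * cnj (signed_fourier \<sigma> f \<xi>)
        = of_real (gaussian a \<xi> * (cmod (signed_fourier \<sigma> f \<xi>))\<^sup>2)" for \<xi>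
      by (simp add: complex_norm_square mult.assoc del: of_real_power)
    have cnjF: "cnj (signed_fourier \<sigma> f \<xi>) = signed_fourier (-\<sigma>) (\<lambda>x. cnj (f x)) \<xi>" for \<xi>
      by (rule cnj_signed_fourier)
    have cf: "integrable lebesgue (\<lambda>x. cnj (f x))" using f1 by simp
    note gF = integrable_gaussian_fourier[OF f1 a, of \<sigma>]
    have "integrable lebesgue (\<lambda>\<xi>. complex_of_real (gaussian a \<xi> * (cmod (signed_fourier \<sigma> f \<xi>))\<^sup>2))"
      using integrable_signed_fourier_mult[OF cf gF, of "-\<sigma>"]
      unfolding sq[symmetric] cnjF by (simp add: mult_ac)
    from integrable_Re[OF this]
    have int: "integrable lebesgue (\<lambda>\<xi>. gaussian a \<xi> * (cmod (signed_fourier \<sigma> f \<xi>))\<^sup>2)"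
      by simp
    have I0: "0 \<le> I" unfolding I_def by (intro Bochner_Integration.integral_nonneg) simp
    have "complex_of_real I = (LINT \<xi>|lebesgue. (of_real (gaussian a \<xi>) * signed_fourier \<sigma> f \<xi>) * cnj (signed_fourier \<sigma> f \<xi>))"
      unfolding I_def sq by (rule integral_complex_of_real[symmetric])
    also have "\<dots> = (LINT x|lebesgue. signed_fourier (-\<sigma>) (\<lambda>\<xi>. of_real (gaussian a \<xi>) * signed_fourier \<sigma> f \<xi>) x * cnj (f x))"
      unfolding cnjF by (rule signed_fourier_multiplication[OF gF cf, symmetric])
    also have "\<dots> = (LINT x|lebesgue. convolution (gauss_kernel a) f x * cnj (f x))"
      unfolding signed_fourier_gaussian_regularization[OF f1 a \<sigma>] ..
    finally have eq: "(LINT x|lebesgue. convolution (gauss_kernel a) f x * cnj (f x)) = complex_of_real I"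
      by (rule sym)
    have "ennreal (I\<^sup>2) \<le> L2_energy (convolution (gauss_kernel a) f) * L2_energy (\<lambda>x. cnj (f x))"
      using norm_integral_L2_mult_le[OF convolution_L2[OF integrable_gauss_kernel[OF a] f2] L2_space_cnj[OF f2]]
      unfolding eq by simp
    also have "\<dots> \<le> L2_energy f * L2_energy f"
      using L2_energy_convolution_le[OF integrable_gauss_kernel[OF a] f2] a
      by (intro mult_mono) (auto simp: nn_integral_gauss_kernel)
    also have "\<dots> = ennreal (e\<^sup>2)" using e by (simp add: power2_eq_square ennreal_mult)
    finally have "I\<^sup>2 \<le> e\<^sup>2" by (simp add: ennreal_le_iff)
    then have "I \<le> e" using e(2) by (rule power2_le_imp_le)
    have "(\<integral>\<^sup>+ \<xi>. ennreal (gaussian a \<xi> * (cmod (signed_fourier \<sigma> f \<xi>))\<^sup>2) \<partial>lebesgue) = ennreal I"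
      unfolding I_def by (rule nn_integral_eq_integral[OF int]) simp
    also have "\<dots> \<le> ennreal e" using \<open>I \<le> e\<close> by (rule ennreal_leI)
    finally show ?thesis .
  qed
  have lim: "(\<lambda>n. ennreal (gaussian (approx_width n) \<xi> * (cmod (signed_fourier \<sigma> f \<xi>))\<^sup>2)) \<longlonglongrightarrow>
      ennreal ((cmod (signed_fourier \<sigma> f \<xi>))\<^sup>2)" for \<xi>
    using tendsto_mult[OF gaussian_approx_tendsto[of \<xi>] tendsto_const[of "(cmod (signed_fourier \<sigma> f \<xi>))\<^sup>2"]]
    by (intro tendsto_ennrealI) simp
  have "L2_energy (signed_fourier \<sigma> f) = (\<integral>\<^sup>+ \<xi>. liminf (\<lambda>n. ennreal (gaussian (approx_width n) \<xi> * (cmod (signed_fourier \<sigma> f \<xi>))\<^sup>2)) \<partial>lebesgue)"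
    unfolding L2_energy_def
    by (intro nn_integral_cong lim_imp_Liminf[symmetric] lim) simp
  also have "\<dots> \<le> liminf (\<lambda>n. \<integral>\<^sup>+ \<xi>. ennreal (gaussian (approx_width n) \<xi> * (cmod (signed_fourier \<sigma> f \<xi>))\<^sup>2) \<partial>lebesgue)"
    by (rule nn_integral_liminf) measurable
  also have "\<dots> \<le> ennreal e"
    by (intro Liminf_le always_eventually allI bound) simp_all
  finally show ?thesis unfolding e(1) .
qed

lemma signed_fourier_L2:
  assumes f: "f \<in> L1_space \<inter> L2_space" and \<sigma>: "\<bar>\<sigma>\<bar> = 1"
  shows "signed_fourier \<sigma> f \<in> L2_space"
proof -
  have "signed_fourier \<sigma> f \<in> borel_measurable lebesgue"
    using f by (intro borel_imp_lebesgue_measurable signed_fourier_measurable) (simp add: L1_space_def)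
  then show ?thesis
    using L2_energy_signed_fourier_le[OF assms] f by (auto simp: L2_space_iff_energy intro: le_less_trans)
qed

lemma signed_fourier_diff:
  assumes "integrable lebesgue f" "integrable lebesgue g"
  shows "signed_fourier \<sigma> (\<lambda>x. f x - g x) \<xi> = signed_fourier \<sigma> f \<xi> - signed_fourier \<sigma> g \<xi>"
  unfolding signed_fourier_def right_diff_distrib
  by (intro Bochner_Integration.integral_diff integrable_phase_mult assms)

lemma L2_energy_signed_fourier_diff_le:
  assumes f: "f \<in> L1_space \<inter> L2_space" and g: "g \<in> L1_space \<inter> L2_space" and \<sigma>: "\<bar>\<sigma>\<bar> = 1"
  shows "L2_energy (\<lambda>\<xi>. signed_fourier \<sigma> f \<xi> - signed_fourier \<sigma> g \<xi>) \<le> L2_energy (\<lambda>x. f x - g x)"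
proof -
  have "(\<lambda>x. f x - g x) \<in> L1_space \<inter> L2_space"
    using f g by (auto simp: L1_space_def intro: L2_space_diff)
  moreover have "signed_fourier \<sigma> (\<lambda>x. f x - g x) = (\<lambda>\<xi>. signed_fourier \<sigma> f \<xi> - signed_fourier \<sigma> g \<xi>)"
    using f g by (intro ext signed_fourier_diff) (auto simp: L1_space_def)
  ultimately show ?thesis
    using L2_energy_signed_fourier_le[of "\<lambda>x. f x - g x" \<sigma>] \<sigma> by simp
qed

section \<open>The extension to square integrable functions\<close>

text \<open>
  \<open>fourier_value \<sigma> u g\<close>: the function \<open>g\<close> represents the transform of \<open>u \<in> L2_space\<close>.  A relation is
  used because the transform is determined only up to null sets.
\<close>

abbreviation fourier_value :: "real \<Rightarrow> (real ^ 'n \<Rightarrow> complex) \<Rightarrow> (real ^ 'n \<Rightarrow> complex) \<Rightarrow> bool" where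
  "fourier_value \<sigma> \<equiv> is_L2_extension_value (signed_fourier \<sigma>)"

lemma fourier_valueD:
  assumes "fourier_value \<sigma> u g"
  shows "u \<in> L2_space" "g \<in> L2_space"
  using assms by (auto simp: is_L2_extension_value_def)

lemma fourier_valueE:
  assumes "fourier_value \<sigma> u g"
  obtains f where "\<And>n. f n \<in> L1_space \<inter> L2_space" "L2_tendsto f u" "L2_tendsto (\<lambda>n. signed_fourier \<sigma> (f n)) g"
proof -
  from assms obtain f where "\<forall>n. f n \<in> L1_space \<inter> L2_space" "L2_tendsto f u"
      "L2_tendsto (\<lambda>n. signed_fourier \<sigma> (f n)) g"
    unfolding is_L2_extension_value_def by (elim conjE exE)
  then show thesis by (intro that) (rule spec)
qed

lemma L2_tendsto_const: "L2_tendsto (\<lambda>_. u) u"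
  by (simp add: L2_tendsto_def)

lemma fourier_value_L1_L2:
  assumes "f \<in> L1_space \<inter> L2_space" "\<bar>\<sigma>\<bar> = 1"
  shows "fourier_value \<sigma> f (signed_fourier \<sigma> f)"
  unfolding is_L2_extension_value_def
  using assms(1) signed_fourier_L2[OF assms]
  by (intro conjI exI[of _ "\<lambda>_. f"] L2_tendsto_const allI) simp_all

lemma L2_tendsto_cong_AE:
  assumes "AE x in lebesgue. u x = v x" "L2_tendsto f u"
  shows "L2_tendsto f v"
proof -
  have "L2_energy (\<lambda>x. f n x - v x) = L2_energy (\<lambda>x. f n x - u x)" for n
    by (rule L2_energy_cong_AE) (use assms(1) in eventually_elim, simp)
  then show ?thesis using assms(2) by (simp add: L2_tendsto_iff_energy)
qed

lemma fourier_value_cong_AE: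
  assumes "fourier_value \<sigma> u g" "AE x in lebesgue. g x = h x" "h \<in> borel_measurable lebesgue"
  shows "fourier_value \<sigma> u h"
proof -
  obtain f where f: "\<And>n. f n \<in> L1_space \<inter> L2_space" "L2_tendsto f u"
      "L2_tendsto (\<lambda>n. signed_fourier \<sigma> (f n)) g"
    using fourier_valueE[OF assms(1)] by blast
  have "h \<in> L2_space" by (rule L2_space_cong_AE[OF fourier_valueD(2)[OF assms(1)] assms(3,2)])
  then show ?thesis
    using f fourier_valueD(1)[OF assms(1)] L2_tendsto_cong_AE[OF assms(2) f(3)]
    unfolding is_L2_extension_value_def by (intro conjI exI[of _ f] allI)
qed

lemma fourier_value_exists:
  fixes u :: "real ^ 'n \<Rightarrow> complex"
  assumes u: "u \<in> L2_space" and \<sigma>: "\<bar>\<sigma>\<bar> = 1"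
  obtains g where "fourier_value \<sigma> u g"
proof -
  obtain f where f: "\<And>n. f n \<in> L1_space \<inter> L2_space" "L2_tendsto f u" using L1_L2_dense[OF u] by blast
  have [measurable]: "u \<in> borel_measurable lebesgue" "f n \<in> borel_measurable lebesgue" for n
    using u f(1) by (auto simp: L2_space_iff_energy)
  have cauchy: "\<exists>N. \<forall>m\<ge>N. \<forall>n\<ge>N. L2_energy (\<lambda>\<xi>. signed_fourier \<sigma> (f m) \<xi> - signed_fourier \<sigma> (f n) \<xi>) \<le> ennreal e"
    if e: "0 < e" for e
  proof -
    have "0 < ennreal (e / 4)" using e by simp
    with f(2) have "\<forall>\<^sub>F n in sequentially. L2_energy (\<lambda>x. f n x - u x) < ennreal (e / 4)"
      unfolding L2_tendsto_iff_energy by (rule order_tendstoD(2))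
    then obtain N where N: "\<And>n. n \<ge> N \<Longrightarrow> L2_energy (\<lambda>x. f n x - u x) < ennreal (e / 4)"
      unfolding eventually_sequentially by blast
    have "L2_energy (\<lambda>\<xi>. signed_fourier \<sigma> (f m) \<xi> - signed_fourier \<sigma> (f n) \<xi>) \<le> ennreal e"
      if "m \<ge> N" "n \<ge> N" for m n
    proof -
      have "L2_energy (\<lambda>\<xi>. signed_fourier \<sigma> (f m) \<xi> - signed_fourier \<sigma> (f n) \<xi>) \<le> L2_energy (\<lambda>x. f m x - f n x)"
        by (intro L2_energy_signed_fourier_diff_le f \<sigma>)
      also have "\<dots> \<le> 2 * L2_energy (\<lambda>x. f m x - u x) + 2 * L2_energy (\<lambda>x. u x - f n x)"
        by (rule L2_energy_diff_le) measurable
      also have "\<dots> \<le> 2 * ennreal (e / 4) + 2 * ennreal (e / 4)"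
        unfolding L2_energy_commute[of u] using N[OF that(1)] N[OF that(2)]
        by (intro add_mono mult_left_mono) auto
      also have "\<dots> = ennreal e"
        using e by (simp flip: ennreal_plus ennreal_mult'' ennreal_numeral)
      finally show ?thesis .
    qed
    then show ?thesis by blast
  qed
  obtain g where "g \<in> L2_space" "L2_tendsto (\<lambda>n. signed_fourier \<sigma> (f n)) g"
    using L2_complete[of "\<lambda>n. signed_fourier \<sigma> (f n)"] signed_fourier_L2[OF f(1) \<sigma>] cauchy by blast
  then have "fourier_value \<sigma> u g" using f u unfolding is_L2_extension_value_def by blast
  then show thesis by (rule that)
qed

text \<open>
  Continuity of the extension.  The constant 16 comes from chaining \<open>L2_energy_diff_le\<close> four times
  and is irrelevant; uniqueness and all limit arguments need only some finite constant.
\<close>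

lemma L2_energy_fourier_value_diff_le:
  fixes u v :: "real ^ 'n \<Rightarrow> complex"
  assumes g: "fourier_value \<sigma> u g" and h: "fourier_value \<sigma> v h" and \<sigma>: "\<bar>\<sigma>\<bar> = 1"
  shows "L2_energy (\<lambda>x. g x - h x) \<le> 16 * L2_energy (\<lambda>x. u x - v x)"
proof -
  obtain f where f: "\<And>n. f n \<in> L1_space \<inter> L2_space" "L2_tendsto f u" "L2_tendsto (\<lambda>n. signed_fourier \<sigma> (f n)) g"
    using fourier_valueE[OF g] by blast
  obtain f' where f': "\<And>n. f' n \<in> L1_space \<inter> L2_space" "L2_tendsto f' v" "L2_tendsto (\<lambda>n. signed_fourier \<sigma> (f' n)) h"
    using fourier_valueE[OF h] by blast
  have L2: "f n \<in> L2_space" "f' n \<in> L2_space" for n using f f' by auto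
  note [measurable] = L2_space_measurable[OF fourier_valueD(1)[OF g]] L2_space_measurable[OF fourier_valueD(2)[OF g]]
    L2_space_measurable[OF fourier_valueD(1)[OF h]] L2_space_measurable[OF fourier_valueD(2)[OF h]]
    L2_space_measurable[OF L2(1)] L2_space_measurable[OF L2(2)]
    L2_space_measurable[OF signed_fourier_L2[OF f(1) \<sigma>]] L2_space_measurable[OF signed_fourier_L2[OF f'(1) \<sigma>]]
  let ?F = "\<lambda>n. signed_fourier \<sigma> (f n)" and ?F' = "\<lambda>n. signed_fourier \<sigma> (f' n)"
  let ?a = "\<lambda>n. L2_energy (\<lambda>x. ?F n x - g x)" and ?b = "\<lambda>n. L2_energy (\<lambda>x. f n x - u x)"
    and ?c = "\<lambda>n. L2_energy (\<lambda>x. f' n x - v x)" and ?d = "\<lambda>n. L2_energy (\<lambda>x. ?F' n x - h x)"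
    and ?E = "L2_energy (\<lambda>x. u x - v x)"
  have "L2_energy (\<lambda>x. g x - h x) \<le> 2 * ?a n + 2 * (2 * (2 * ?b n + 2 * (2 * ?E + 2 * ?c n)) + 2 * ?d n)" for n
  proof -
    have "L2_energy (\<lambda>x. ?F n x - ?F' n x) \<le> L2_energy (\<lambda>x. f n x - f' n x)"
      by (intro L2_energy_signed_fourier_diff_le f f' \<sigma>)
    also have "\<dots> \<le> 2 * ?b n + 2 * L2_energy (\<lambda>x. u x - f' n x)"
      by (rule L2_energy_diff_le) measurable
    also have "\<dots> \<le> 2 * ?b n + 2 * (2 * ?E + 2 * ?c n)"
      unfolding L2_energy_commute[of "f' n"]
      by (intro add_left_mono mult_left_mono L2_energy_diff_le; (measurable | simp))
    finally have 1: "L2_energy (\<lambda>x. ?F n x - ?F' n x) \<le> 2 * ?b n + 2 * (2 * ?E + 2 * ?c n)" .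
    have "L2_energy (\<lambda>x. ?F n x - h x) \<le> 2 * L2_energy (\<lambda>x. ?F n x - ?F' n x) + 2 * ?d n"
      by (rule L2_energy_diff_le) measurable
    also have "\<dots> \<le> 2 * (2 * ?b n + 2 * (2 * ?E + 2 * ?c n)) + 2 * ?d n"
      by (intro add_right_mono mult_left_mono 1) simp
    finally have 2: "L2_energy (\<lambda>x. ?F n x - h x) \<le> 2 * (2 * ?b n + 2 * (2 * ?E + 2 * ?c n)) + 2 * ?d n" .
    have "L2_energy (\<lambda>x. g x - h x) \<le> 2 * ?a n + 2 * L2_energy (\<lambda>x. ?F n x - h x)"
      unfolding L2_energy_commute[of "?F n" g] by (rule L2_energy_diff_le) measurable
    also have "\<dots> \<le> 2 * ?a n + 2 * (2 * (2 * ?b n + 2 * (2 * ?E + 2 * ?c n)) + 2 * ?d n)"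
      by (intro add_left_mono mult_left_mono 2) simp
    finally show ?thesis .
  qed
  moreover have "(\<lambda>n. 2 * ?a n + 2 * (2 * (2 * ?b n + 2 * (2 * ?E + 2 * ?c n)) + 2 * ?d n))
     \<longlonglongrightarrow> 2 * 0 + 2 * (2 * (2 * 0 + 2 * (2 * ?E + 2 * 0)) + 2 * 0)"
    using f(2,3) f'(2,3) unfolding L2_tendsto_iff_energy
    by (intro tendsto_add ennreal_tendsto_cmult tendsto_const) auto
  ultimately have "L2_energy (\<lambda>x. g x - h x) \<le> 2 * 0 + 2 * (2 * (2 * 0 + 2 * (2 * ?E + 2 * 0)) + 2 * 0)"
    by (intro LIMSEQ_le_const) auto
  then show ?thesis by (simp flip: mult.assoc)
qed

lemma fourier_value_unique:
  assumes "fourier_value \<sigma> u g" "fourier_value \<sigma> v h" "AE x in lebesgue. u x = v x" "\<bar>\<sigma>\<bar> = 1"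
  shows "AE x in lebesgue. g x = h x"
proof -
  note m = L2_space_measurable[OF fourier_valueD(1)] L2_space_measurable[OF fourier_valueD(2)]
  have "L2_energy (\<lambda>x. u x - v x) = 0"
    using assms by (subst L2_energy_diff_eq_0_iff) (auto intro: m)
  then have "L2_energy (\<lambda>x. g x - h x) = 0"
    using L2_energy_fourier_value_diff_le[OF assms(1,2,4)] by simp
  then show ?thesis
    using assms by (subst (asm) L2_energy_diff_eq_0_iff) (auto intro: m)
qed

lemma fourier_value_multiplication:
  assumes g: "fourier_value \<sigma> u g" and h: "fourier_value \<sigma> v h" and \<sigma>: "\<bar>\<sigma>\<bar> = 1"
  shows "(LINT x|lebesgue. g x * v x) = (LINT x|lebesgue. u x * h x)"
proof -
  obtain f where f: "\<And>n. f n \<in> L1_space \<inter> L2_space" "L2_tendsto f u" "L2_tendsto (\<lambda>n. signed_fourier \<sigma> (f n)) g"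
    using fourier_valueE[OF g] by blast
  obtain f' where f': "\<And>n. f' n \<in> L1_space \<inter> L2_space" "L2_tendsto f' v" "L2_tendsto (\<lambda>n. signed_fourier \<sigma> (f' n)) h"
    using fourier_valueE[OF h] by blast
  have "(\<lambda>n. LINT x|lebesgue. signed_fourier \<sigma> (f n) x * f' n x) \<longlonglongrightarrow> (LINT x|lebesgue. g x * v x)"
    using f f' fourier_valueD[OF g] fourier_valueD[OF h] signed_fourier_L2[OF _ \<sigma>]
    by (intro integral_L2_mult_tendsto) auto
  moreover have "(\<lambda>n. LINT x|lebesgue. f n x * signed_fourier \<sigma> (f' n) x) \<longlonglongrightarrow> (LINT x|lebesgue. u x * h x)"
    using f f' fourier_valueD[OF g] fourier_valueD[OF h] signed_fourier_L2[OF _ \<sigma>]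
    by (intro integral_L2_mult_tendsto) auto
  moreover have "(LINT x|lebesgue. signed_fourier \<sigma> (f n) x * f' n x) = (LINT x|lebesgue. f n x * signed_fourier \<sigma> (f' n) x)" for n
    using f(1) f'(1) by (intro signed_fourier_multiplication) (auto simp: L1_space_def)
  ultimately show ?thesis by (simp add: LIMSEQ_unique)
qed

lemma fourier_value_cnj:
  assumes "fourier_value \<sigma> u g"
  shows "fourier_value (-\<sigma>) (\<lambda>x. cnj (u x)) (\<lambda>x. cnj (g x))"
proof -
  obtain f where f: "\<And>n. f n \<in> L1_space \<inter> L2_space" "L2_tendsto f u" "L2_tendsto (\<lambda>n. signed_fourier \<sigma> (f n)) g"
    using fourier_valueE[OF assms] by blast
  have norm_cnj: "cmod (cnj a - cnj b) = cmod (a - b)" for a b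
    unfolding complex_cnj_diff[symmetric] by (rule complex_mod_cnj)
  have "L2_tendsto (\<lambda>n x. cnj (f n x)) (\<lambda>x. cnj (u x))"
    using f(2) unfolding L2_tendsto_def norm_cnj .
  moreover have "L2_tendsto (\<lambda>n. signed_fourier (-\<sigma>) (\<lambda>x. cnj (f n x))) (\<lambda>x. cnj (g x))"
    using f(3) unfolding L2_tendsto_def cnj_signed_fourier[symmetric] norm_cnj .
  moreover have "(\<lambda>x. cnj (f n x)) \<in> L1_space \<inter> L2_space" for n
    using f(1)[of n] by (simp add: L1_space_def L2_space_cnj)
  ultimately show ?thesis
    using fourier_valueD[OF assms, THEN L2_space_cnj] unfolding is_L2_extension_value_def
    by (intro conjI exI[of _ "\<lambda>n x. cnj (f n x)"] allI)
qed

section \<open>Inversion and the identity of Parseval\<close>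

lemma AE_nonpos_if_compact_integrals_0:
  fixes r :: "real ^ 'n \<Rightarrow> real"
  assumes [measurable]: "r \<in> borel_measurable lebesgue"
    and int: "\<And>K. compact K \<Longrightarrow> integrable lebesgue (\<lambda>x. indicator K x * r x)"
    and zero: "\<And>K. compact K \<Longrightarrow> (LINT x|lebesgue. indicator K x * r x) = 0"
  shows "AE x in lebesgue. r x \<le> 0"
proof -
  define A where "A m = {x. 0 < r x} \<inter> cball 0 (real m)" for m
  have pos: "{x. 0 < r x} \<in> sets lebesgue"
    using measurable_sets[OF assms(1), of "{0<..}"] by (simp add: vimage_def)
  have A: "A m \<in> sets lebesgue" for m
    unfolding A_def by (intro sets.Int pos) (simp add: lmeasurable_cball fmeasurableD)
  have fin: "emeasure lebesgue (A m) < \<infinity>" for m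
  proof -
    have "emeasure lebesgue (A m) \<le> emeasure lebesgue (cball 0 (real m) :: (real ^ 'n) set)"
      by (intro emeasure_mono) (auto simp: A_def lmeasurable_cball fmeasurableD)
    also have "\<dots> < \<infinity>" using lmeasurable_cball[of "0 :: real ^ 'n" "real m"] by (simp add: fmeasurable_def)
    finally show ?thesis .
  qed
  have null: "emeasure lebesgue (A m) = 0" for m
  proof (rule ccontr)
    assume "emeasure lebesgue (A m) \<noteq> 0"
    then obtain e where e: "emeasure lebesgue (A m) = ennreal e" "0 < e"
      using fin[of m] by (cases "emeasure lebesgue (A m)" rule: ennreal_cases) (auto simp: less_le)
    \<comment> \<open>Inner regularity: a compact subset of \<open>A m\<close> of positive measure.\<close>
    obtain T where T: "closed T" "T \<subseteq> A m" "A m - T \<in> lmeasurable" "emeasure lebesgue (A m - T) < ennreal e"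
      using sets_lebesgue_inner_closed[OF A[of m] e(2)] .
    have "bounded T" by (rule bounded_subset[OF bounded_cball]) (use T(2) in \<open>auto simp: A_def\<close>)
    with T(1) have K: "compact T" by (simp add: compact_eq_bounded_closed)
    have Ts: "T \<in> sets lebesgue" using T(1) by (simp add: borel_closed)
    have "AE x in lebesgue. 0 \<le> indicator T x * r x"
      using T(2) by (intro AE_I2) (auto simp: A_def indicator_def)
    with zero[OF K] int[OF K] have "AE x in lebesgue. indicator T x * r x = 0"
      using integral_nonneg_eq_0_iff_AE[OF int[OF K]] by blast
    then have "AE x in lebesgue. x \<notin> T"
      by eventually_elim (use T(2) in \<open>auto simp: A_def indicator_def split: if_splits\<close>)
    then have "emeasure lebesgue T = 0"
      using Ts by (simp add: AE_iff_null_sets null_setsD1)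
    moreover have "emeasure lebesgue (A m - T) + emeasure lebesgue T = emeasure lebesgue (A m)"
    proof -
      have "A m - T \<union> T = A m" using T(2) by blast
      then show ?thesis using plus_emeasure[of "A m - T" lebesgue T] sets.Diff[OF A Ts] Ts by (metis Diff_disjoint inf_commute)
    qed
    ultimately have "ennreal e = emeasure lebesgue (A m - T)" unfolding e(1) by (metis add.right_neutral)
    then show False using T(4) by (metis less_irrefl)
  qed
  have "AE x in lebesgue. x \<notin> A m" for m
    using null[of m] A[of m] by (subst AE_iff_null_sets[symmetric]) auto
  then have "AE x in lebesgue. \<forall>m. x \<notin> A m" by (simp add: AE_all_countable)
  then show ?thesis
  proof eventually_elim
    case (elim x)
    obtain m where "norm x \<le> real m" using real_arch_simple by blast
    with elim show ?case by (auto simp: A_def not_less)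
  qed
qed

lemma AE_eq_0_if_test_integrals_0:
  fixes w :: "real ^ 'n \<Rightarrow> complex"
  assumes w: "w \<in> L2_space"
    and test: "\<And>\<phi> R. \<lbrakk>continuous_on UNIV \<phi>; \<And>x. 0 \<le> \<phi> x \<and> \<phi> x \<le> 1; \<And>x. x \<notin> cball 0 R \<Longrightarrow> \<phi> x = 0\<rbrakk>
      \<Longrightarrow> (LINT x|lebesgue. w x * complex_of_real (\<phi> x)) = 0"
  shows "AE x in lebesgue. w x = 0"
proof -
  have [measurable]: "w \<in> borel_measurable lebesgue" by (rule L2_space_measurable[OF w])
  have ball: "integrable lebesgue (\<lambda>x. indicator (cball 0 R) x * w x)" for R
    by (rule integrable_L2_mult[OF indicator_cball_L2 w])
  have K: "integrable lebesgue (\<lambda>x. complex_of_real (indicator K x) * w x) \<and> (LINT x|lebesgue. complex_of_real (indicator K x) * w x) = 0"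
    if "compact K" for K
  proof (cases "K = {}")
    case False
    have cl: "closed K" and Ks: "K \<in> sets lebesgue"
      using \<open>compact K\<close> by (auto simp: compact_imp_closed borel_compact)
    obtain R where R: "\<And>y. y \<in> K \<Longrightarrow> norm y \<le> R"
      using compact_imp_bounded[OF \<open>compact K\<close>] unfolding bounded_iff by blast
    \<comment> \<open>Continuous functions decreasing to the indicator of \<open>K\<close>.\<close>
    define \<phi> where "\<phi> j x = max 0 (1 - real (Suc j) * infdist x K)" for j x
    have supp: "\<phi> j x = 0" if "x \<notin> cball 0 (R + 1)" for j x
    proof -
      obtain y where y: "y \<in> K" "infdist x K = dist x y"
        using infdist_attains_inf[OF cl False, of x] by blast
      have "norm x \<le> dist x y + norm y" using norm_triangle_sub[of x y] by (simp add: dist_norm)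
      then have "1 \<le> infdist x K" using R[OF y(1)] that y(2) by simp
      then have "1 * 1 \<le> real (Suc j) * infdist x K" by (intro mult_mono) auto
      then show ?thesis by (simp add: \<phi>_def)
    qed
    have range: "0 \<le> \<phi> j x \<and> \<phi> j x \<le> 1" for j x
      by (auto simp: \<phi>_def infdist_nonneg)
    have cont: "continuous_on UNIV (\<phi> j)" for j
      unfolding \<phi>_def[abs_def] by (intro continuous_intros)
    have meas: "\<phi> j \<in> borel_measurable lebesgue" for j
      by (intro borel_imp_lebesgue_measurable borel_measurable_continuous_onI cont)
    have zero: "(LINT x|lebesgue. w x * complex_of_real (\<phi> j x)) = 0" for j
      by (rule test[OF cont range supp])
    have lim: "(\<lambda>j. \<phi> j x) \<longlonglongrightarrow> indicator K x" for x
    proof (cases "x \<in> K")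
      case False
      then have pos: "0 < infdist x K"
        using in_closed_iff_infdist_zero[OF cl \<open>K \<noteq> {}\<close>, of x] infdist_nonneg[of x K] by linarith
      obtain j0 where "1 < real j0 * infdist x K" using ex_less_of_nat_mult[OF pos] by blast
      have "\<phi> j x = 0" if "j \<ge> j0" for j
      proof -
        have "real j0 * infdist x K \<le> real (Suc j) * infdist x K"
          using that pos by (intro mult_right_mono) auto
        then show ?thesis using \<open>1 < _\<close> by (simp add: \<phi>_def)
      qed
      then show ?thesis using False
        by (intro tendsto_eventually) (auto simp: eventually_sequentially)
    qed (simp add: \<phi>_def)
    have indK: "(\<lambda>x. complex_of_real (indicator K x) * w x) \<in> borel_measurable lebesgue"
      using Ks by measurable
    have intK: "integrable lebesgue (\<lambda>x. complex_of_real (indicator K x) * w x)"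
      by (rule Bochner_Integration.integrable_bound[OF ball[of R] indK])
         (use R in \<open>auto simp: norm_mult indicator_def\<close>)
    have "(\<lambda>j. LINT x|lebesgue. w x * complex_of_real (\<phi> j x)) \<longlonglongrightarrow> (LINT x|lebesgue. complex_of_real (indicator K x) * w x)"
    proof (rule integral_dominated_convergence[where w = "\<lambda>x. cmod (indicator (cball 0 (R + 1)) x * w x)"])
      show "integrable lebesgue (\<lambda>x. cmod (indicator (cball 0 (R + 1)) x * w x))"
        by (rule integrable_norm[OF ball])
      show "(\<lambda>x. w x * complex_of_real (\<phi> j x)) \<in> borel_measurable lebesgue" for j
        using meas[of j] by measurable
      have "(\<lambda>j. w x * complex_of_real (\<phi> j x)) \<longlonglongrightarrow> complex_of_real (indicator K x) * w x" for x
        using tendsto_mult[OF tendsto_const[of "w x"] tendsto_of_real[OF lim]] by (simp only: mult.commute)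
      then show "AE x in lebesgue. (\<lambda>j. w x * complex_of_real (\<phi> j x)) \<longlonglongrightarrow> complex_of_real (indicator K x) * w x"
        by (intro AE_I2)
      have "cmod (w x * complex_of_real (\<phi> j x)) \<le> cmod (indicator (cball 0 (R + 1)) x * w x)" for j x
      proof (cases "x \<in> cball 0 (R + 1)")
        case True
        then show ?thesis using range[of j x] by (simp add: norm_mult mult_right_le_one_le)
      qed (simp add: supp)
      then show "AE x in lebesgue. norm (w x * complex_of_real (\<phi> j x)) \<le> cmod (indicator (cball 0 (R + 1)) x * w x)" for j
        by (intro AE_I2)
    qed (rule indK)
    then have "(LINT x|lebesgue. complex_of_real (indicator K x) * w x) = 0"
      unfolding zero by (rule LIMSEQ_unique) (rule tendsto_const)
    with intK show ?thesis by (rule conjI)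
  qed simp
  have *: "AE x in lebesgue. Re (c * w x) \<le> 0" for c
  proof (rule AE_nonpos_if_compact_integrals_0)
    fix K :: "(real ^ 'n) set" assume "compact K"
    note I = integrable_mult_right[OF conjunct1[OF K[OF this]], of c]
    have eq: "indicator K x * Re (c * w x) = Re (c * (complex_of_real (indicator K x) * w x))" for x
      by (simp add: indicator_def)
    show "integrable lebesgue (\<lambda>x. indicator K x * Re (c * w x))"
      unfolding eq by (rule integrable_Re[OF I])
    show "(LINT x|lebesgue. indicator K x * Re (c * w x)) = 0"
      unfolding eq integral_Re[OF I] using K[OF \<open>compact K\<close>] by simp
  qed measurable
  \<comment> \<open>Nonpositive real parts of \<open>w\<close>, \<open>-w\<close>, \<open>\<i> w\<close> and \<open>-\<i> w\<close> together force \<open>w = 0\<close>.\<close>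
  show ?thesis using *[of 1] *[of "-1"] *[of "\<i>"] *[of "-\<i>"]
    by eventually_elim (auto simp: complex_eq_iff)
qed

lemma convolution_gauss_kernel_rescaled:
  fixes \<phi> :: "real ^ 'n \<Rightarrow> complex"
  assumes [measurable]: "\<phi> \<in> borel_measurable borel"
  shows "convolution (gauss_kernel (approx_width n)) \<phi> x
    = (LINT z|lborel. of_real (gaussian 1 z) * \<phi> (x - (1 / real (Suc n)) *\<^sub>R z))"
proof -
  define k where "k = real (Suc n)"
  have k: "k > 0" by (simp add: k_def)
  have a: "approx_width n = 1 / k\<^sup>2" by (simp add: approx_width_def k_def)
  have "convolution (gauss_kernel (approx_width n)) \<phi> x = (LINT y|lborel. gauss_kernel (1 / k\<^sup>2) (x - y) * \<phi> y)"
    unfolding a by (rule convolution_borel) measurable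
  also have "\<dots> = \<bar>- (1 / k)\<bar> ^ DIM(real ^ 'n) *\<^sub>R
      (LINT z|lborel. gauss_kernel (1 / k\<^sup>2) (x - (x + (- (1 / k)) *\<^sub>R z)) * \<phi> (x + (- (1 / k)) *\<^sub>R z))"
    using k by (intro integral_lborel_affine) auto
  also have "\<dots> = (LINT z|lborel. (1 / k) ^ CARD('n) *\<^sub>R
      (gauss_kernel (1 / k\<^sup>2) ((1 / k) *\<^sub>R z) * \<phi> (x - (1 / k) *\<^sub>R z)))"
    using k by simp
  also have "\<dots> = (LINT z|lborel. of_real (gaussian 1 z) * \<phi> (x - (1 / k) *\<^sub>R z))"
  proof (rule Bochner_Integration.integral_cong[OF refl])
    fix z :: "real ^ 'n"
    have "gauss_kernel (1 / k\<^sup>2) ((1 / k) *\<^sub>R z) = of_real (gaussian 1 z / (1 / k) ^ CARD('n))"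
      using k by (simp add: gauss_kernel_def gaussian_def real_sqrt_divide power_divide power_mult_distrib)
    then show "(1 / k) ^ CARD('n) *\<^sub>R (gauss_kernel (1 / k\<^sup>2) ((1 / k) *\<^sub>R z) * \<phi> (x - (1 / k) *\<^sub>R z))
      = of_real (gaussian 1 z) * \<phi> (x - (1 / k) *\<^sub>R z)"
      using k by (simp add: scaleR_conv_of_real[of "(1 / k) ^ CARD('n)"])
  qed
  finally show ?thesis by (simp add: k_def)
qed

lemma
  fixes \<phi> :: "real ^ 'n \<Rightarrow> complex"
  assumes cont: "continuous_on UNIV \<phi>" and bound: "\<And>x. cmod (\<phi> x) \<le> 1"
  shows convolution_gauss_kernel_tendsto: "(\<lambda>n. convolution (gauss_kernel (approx_width n)) \<phi> x) \<longlonglongrightarrow> \<phi> x"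
    and norm_convolution_gauss_kernel_le: "cmod (convolution (gauss_kernel (approx_width n)) \<phi> x) \<le> 1"
proof -
  have [measurable]: "\<phi> \<in> borel_measurable borel" using cont by (rule borel_measurable_continuous_onI)
  have g: "integrable lborel (gaussian 1 :: real ^ 'n \<Rightarrow> real)" by (rule integrable_gaussian) simp
  have le: "cmod (of_real (gaussian 1 z) * \<phi> y) \<le> gaussian 1 z" for z y
    using bound[of y] by (simp add: norm_mult mult_right_le_one_le)
  have "(\<lambda>n. LINT z|lborel. of_real (gaussian 1 z) * \<phi> (x - (1 / real (Suc n)) *\<^sub>R z))
      \<longlonglongrightarrow> (LINT z|lborel. of_real (gaussian 1 (z :: real ^ 'n)) * \<phi> x)"
  proof (rule integral_dominated_convergence[where w = "gaussian 1 :: real ^ 'n \<Rightarrow> real"])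
    show "AE z in lborel. (\<lambda>n. of_real (gaussian 1 z) * \<phi> (x - (1 / real (Suc n)) *\<^sub>R z)) \<longlonglongrightarrow> of_real (gaussian 1 z) * \<phi> x"
    proof (intro AE_I2 tendsto_mult tendsto_const)
      fix z
      have "(\<lambda>n. x - (1 / real (Suc n)) *\<^sub>R z) \<longlonglongrightarrow> x - 0 *\<^sub>R z"
        by (intro tendsto_intros LIMSEQ_Suc[OF lim_1_over_n])
      then show "(\<lambda>n. \<phi> (x - (1 / real (Suc n)) *\<^sub>R z)) \<longlonglongrightarrow> \<phi> x"
        using continuous_on_tendsto_compose[OF cont, of "\<lambda>n. x - (1 / real (Suc n)) *\<^sub>R z" x sequentially] by simp
    qed
  qed (use le g in auto)
  also have "(LINT z|lborel. of_real (gaussian 1 (z :: real ^ 'n)) * \<phi> x) = \<phi> x"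
    by (simp add: integral_gaussian)
  finally show "(\<lambda>n. convolution (gauss_kernel (approx_width n)) \<phi> x) \<longlonglongrightarrow> \<phi> x"
    by (simp add: convolution_gauss_kernel_rescaled)
  have "cmod (convolution (gauss_kernel (approx_width n)) \<phi> x) \<le> (LINT z|lborel. gaussian 1 (z :: real ^ 'n))"
    unfolding convolution_gauss_kernel_rescaled[OF \<open>\<phi> \<in> _\<close>]
    by (rule integral_norm_bound[THEN order_trans]) (intro integral_mono' g le; simp)
  then show "cmod (convolution (gauss_kernel (approx_width n)) \<phi> x) \<le> 1" by (simp add: integral_gaussian)
qed

text \<open>
  Gaussian averaging is symmetric for the bilinear pairing.  Two uses of the multiplication formula
  replace a further application of Fubini's theorem.
\<close>

lemma integral_convolution_gauss_kernel:
  fixes f \<phi> :: "real ^ 'n \<Rightarrow> complex"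
  assumes f: "integrable lebesgue f" and \<phi>: "integrable lebesgue \<phi>" and a: "0 < a"
  shows "(LINT x|lebesgue. convolution (gauss_kernel a) f x * \<phi> x) = (LINT x|lebesgue. f x * convolution (gauss_kernel a) \<phi> x)"
proof -
  let ?\<gamma> = "\<lambda>\<xi>. complex_of_real (gaussian a \<xi>)"
  have "(LINT x|lebesgue. convolution (gauss_kernel a) f x * \<phi> x)
      = (LINT x|lebesgue. signed_fourier (-1) (\<lambda>\<xi>. ?\<gamma> \<xi> * signed_fourier 1 f \<xi>) x * \<phi> x)"
    by (simp add: signed_fourier_gaussian_regularization[OF f a])
  also have "\<dots> = (LINT \<xi>|lebesgue. (?\<gamma> \<xi> * signed_fourier 1 f \<xi>) * signed_fourier (-1) \<phi> \<xi>)"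
    by (rule signed_fourier_multiplication[OF integrable_gaussian_fourier[OF f a] \<phi>])
  also have "\<dots> = (LINT \<xi>|lebesgue. signed_fourier 1 f \<xi> * (?\<gamma> \<xi> * signed_fourier (-1) \<phi> \<xi>))"
    by (simp add: mult_ac)
  also have "\<dots> = (LINT x|lebesgue. f x * signed_fourier 1 (\<lambda>\<xi>. ?\<gamma> \<xi> * signed_fourier (-1) \<phi> \<xi>) x)"
    by (rule signed_fourier_multiplication[OF f integrable_gaussian_fourier[OF \<phi> a]])
  also have "\<dots> = (LINT x|lebesgue. f x * convolution (gauss_kernel a) \<phi> x)"
    using signed_fourier_gaussian_regularization[OF \<phi> a, of "-1"] by simp
  finally show ?thesis .
qed

lemma L2_tendsto_if_energy_le:
  assumes "\<And>n. L2_energy (\<lambda>x. f n x - u x) \<le> C * b n" "b \<longlonglongrightarrow> 0" "C < top"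
  shows "L2_tendsto f u"
  unfolding L2_tendsto_iff_energy
proof (rule tendsto_sandwich[OF _ _ tendsto_const[of 0]])
  show "(\<lambda>n. C * b n) \<longlonglongrightarrow> 0"
    using ennreal_tendsto_cmult[OF assms(3,2)] by simp
  show "\<forall>\<^sub>F n in sequentially. L2_energy (\<lambda>x. f n x - u x) \<le> C * b n"
    by (intro always_eventually allI assms(1))
qed simp

text \<open>
  The Gaussian averages \<open>?p n\<close> of \<open>f\<close> converge to \<open>h\<close> in \<open>L2\<close>, because \<open>?p n\<close> is the inverse
  transform of a Gaussian multiple of the transform of \<open>f\<close>, and they converge to \<open>f\<close> when tested against
  continuous functions of compact support.
\<close>

lemma fourier_value_inversion_L1_L2:
  fixes f :: "real ^ 'n \<Rightarrow> complex"
  assumes f: "f \<in> L1_space \<inter> L2_space" and \<sigma>: "\<bar>\<sigma>\<bar> = 1"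
    and h: "fourier_value (-\<sigma>) (signed_fourier \<sigma> f) h"
  shows "AE x in lebesgue. h x = f x"
proof -
  have f1: "integrable lebesgue f" and f2: "f \<in> L2_space" using f by (auto simp: L1_space_def)
  have h2: "h \<in> L2_space" by (rule fourier_valueD[OF h])
  let ?q = "\<lambda>n \<xi>. complex_of_real (gaussian (approx_width n) \<xi>) * signed_fourier \<sigma> f \<xi>"
  let ?p = "\<lambda>n. convolution (gauss_kernel (approx_width n)) f"
  have gm: "(\<lambda>\<xi>. complex_of_real (gaussian a \<xi>)) \<in> borel_measurable lebesgue" for a
    by (intro borel_imp_lebesgue_measurable) measurable
  have g1: "cmod (complex_of_real (gaussian (approx_width n) \<xi>)) \<le> 1" for n and \<xi> :: "real ^ 'n"
    by (simp add: gaussian_le_1 less_imp_le)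
  have q: "?q n \<in> L1_space \<inter> L2_space" for n
    using L2_space_mult[OF signed_fourier_L2[OF f \<sigma>] gm g1] integrable_gaussian_fourier[OF f1]
    by (auto simp: L1_space_def)
  have qlim: "L2_tendsto ?q (signed_fourier \<sigma> f)"
    using tendsto_of_real[OF gaussian_approx_tendsto]
    by (intro L2_tendsto_multiplier signed_fourier_L2[OF f \<sigma>] gm g1) simp
  have plim: "L2_tendsto ?p h"
  proof (rule L2_tendsto_if_energy_le)
    show "L2_energy (\<lambda>x. ?p n x - h x) \<le> 16 * L2_energy (\<lambda>\<xi>. ?q n \<xi> - signed_fourier \<sigma> f \<xi>)" for n
      using L2_energy_fourier_value_diff_le[OF fourier_value_L1_L2[OF q, of "-\<sigma>" n] h] \<sigma>
      by (simp add: signed_fourier_gaussian_regularization[OF f1 _ \<sigma>])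
    show "(\<lambda>n. L2_energy (\<lambda>\<xi>. ?q n \<xi> - signed_fourier \<sigma> f \<xi>)) \<longlonglongrightarrow> 0"
      using qlim unfolding L2_tendsto_iff_energy .
  qed simp
  have "AE x in lebesgue. h x - f x = 0"
  proof (rule AE_eq_0_if_test_integrals_0[OF L2_space_diff[OF h2 f2]])
    fix \<phi> :: "real ^ 'n \<Rightarrow> real" and R
    assume cont: "continuous_on UNIV \<phi>" and range: "\<And>x. 0 \<le> \<phi> x \<and> \<phi> x \<le> 1"
      and supp: "\<And>x. x \<notin> cball 0 R \<Longrightarrow> \<phi> x = 0"
    let ?\<phi> = "\<lambda>x. complex_of_real (\<phi> x)"
    have c\<phi>: "continuous_on UNIV ?\<phi>" using cont by (intro continuous_intros)
    have b\<phi>: "cmod (?\<phi> x) \<le> 1" for x using range[of x] by simp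
    have m\<phi>: "?\<phi> \<in> borel_measurable lebesgue"
      by (intro borel_imp_lebesgue_measurable borel_measurable_continuous_onI c\<phi>)
    have supp': "(\<lambda>x. ?\<phi> x * indicator (cball 0 R) x) = ?\<phi>"
      using supp by (intro ext) (auto simp: indicator_def)
    have \<phi>2: "?\<phi> \<in> L2_space"
      using L2_space_mult[OF indicator_cball_L2[of 0 R] m\<phi> b\<phi>] unfolding supp' .
    have \<phi>1: "integrable lebesgue ?\<phi>"
      using integrable_L2_mult[OF \<phi>2 indicator_cball_L2[of 0 R]] unfolding supp' .
    have p2: "?p n \<in> L2_space" for n
      by (intro convolution_L2 integrable_gauss_kernel f2) simp
    have "(\<lambda>n. LINT x|lebesgue. ?p n x * ?\<phi> x) \<longlonglongrightarrow> (LINT x|lebesgue. h x * ?\<phi> x)"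
      by (intro integral_L2_mult_tendsto p2 h2 plim \<phi>2 L2_tendsto_const)
    moreover have "(LINT x|lebesgue. ?p n x * ?\<phi> x)
        = (LINT x|lebesgue. f x * convolution (gauss_kernel (approx_width n)) ?\<phi> x)" for n
      by (rule integral_convolution_gauss_kernel[OF f1 \<phi>1]) simp
    moreover have "(\<lambda>n. LINT x|lebesgue. f x * convolution (gauss_kernel (approx_width n)) ?\<phi> x)
        \<longlonglongrightarrow> (LINT x|lebesgue. f x * ?\<phi> x)"
    proof (rule integral_dominated_convergence)
      show "integrable lebesgue (\<lambda>x. cmod (f x))" using f1 by simp
      show "AE x in lebesgue. (\<lambda>n. f x * convolution (gauss_kernel (approx_width n)) ?\<phi> x) \<longlonglongrightarrow> f x * ?\<phi> x"
        by (intro AE_I2 tendsto_mult tendsto_const convolution_gauss_kernel_tendsto c\<phi> b\<phi>)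
      show "AE x in lebesgue. norm (f x * convolution (gauss_kernel (approx_width n)) ?\<phi> x) \<le> cmod (f x)" for n
        using norm_convolution_gauss_kernel_le[OF c\<phi> b\<phi>]
        by (intro AE_I2) (simp add: norm_mult mult_right_le_one_le)
      show "(\<lambda>x. f x * convolution (gauss_kernel (approx_width n)) ?\<phi> x) \<in> borel_measurable lebesgue" for n
        by (intro borel_measurable_times borel_measurable_integrable[OF f1]
            L2_space_measurable[OF convolution_L2[OF integrable_gauss_kernel \<phi>2]]) simp
      show "(\<lambda>x. f x * ?\<phi> x) \<in> borel_measurable lebesgue"
        by (intro borel_measurable_times borel_measurable_integrable[OF f1] m\<phi>)
    qed
    ultimately have "(LINT x|lebesgue. h x * ?\<phi> x) = (LINT x|lebesgue. f x * ?\<phi> x)"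
      by (simp add: LIMSEQ_unique)
    then show "(LINT x|lebesgue. (h x - f x) * ?\<phi> x) = 0"
      unfolding left_diff_distrib
      by (subst Bochner_Integration.integral_diff) (simp_all add: integrable_L2_mult h2 f2 \<phi>2)
  qed
  then show ?thesis by simp
qed

lemma L2_tendsto_unique:
  assumes u: "L2_tendsto f u" "u \<in> L2_space" and v: "L2_tendsto f v" "v \<in> L2_space"
    and f: "\<And>n. f n \<in> L2_space"
  shows "AE x in lebesgue. u x = v x"
proof -
  note [measurable] = L2_space_measurable[OF u(2)] L2_space_measurable[OF v(2)] L2_space_measurable[OF f]
  have "L2_energy (\<lambda>x. u x - v x) \<le> 2 * L2_energy (\<lambda>x. f n x - u x) + 2 * L2_energy (\<lambda>x. f n x - v x)" for n
    unfolding L2_energy_commute[of "f n" u] by (rule L2_energy_diff_le) measurable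
  moreover have "(\<lambda>n. 2 * L2_energy (\<lambda>x. f n x - u x) + 2 * L2_energy (\<lambda>x. f n x - v x)) \<longlonglongrightarrow> 2 * 0 + 2 * 0"
    using u v unfolding L2_tendsto_iff_energy by (intro tendsto_add ennreal_tendsto_cmult) auto
  ultimately have "L2_energy (\<lambda>x. u x - v x) \<le> 2 * 0 + 2 * 0"
    by (intro LIMSEQ_le_const) auto
  then show ?thesis by (simp add: L2_energy_diff_eq_0_iff)
qed

lemma fourier_value_inversion:
  fixes u :: "real ^ 'n \<Rightarrow> complex"
  assumes g: "fourier_value \<sigma> u g" and h: "fourier_value (-\<sigma>) g h" and \<sigma>: "\<bar>\<sigma>\<bar> = 1"
  shows "AE x in lebesgue. h x = u x"
proof -
  obtain f where f: "\<And>n. f n \<in> L1_space \<inter> L2_space" "L2_tendsto f u" "L2_tendsto (\<lambda>n. signed_fourier \<sigma> (f n)) g"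
    using fourier_valueE[OF g] by blast
  have f2: "f n \<in> L2_space" for n using f(1) by simp
  have \<sigma>': "\<bar>-\<sigma>\<bar> = 1" using \<sigma> by simp
  have "L2_tendsto f h"
  proof (rule L2_tendsto_if_energy_le)
    show "L2_energy (\<lambda>x. f n x - h x) \<le> 16 * L2_energy (\<lambda>\<xi>. signed_fourier \<sigma> (f n) \<xi> - g \<xi>)" for n
    proof -
      obtain k where k: "fourier_value (-\<sigma>) (signed_fourier \<sigma> (f n)) k"
        using fourier_value_exists[OF signed_fourier_L2[OF f(1) \<sigma>] \<sigma>'] by blast
      have "fourier_value (-\<sigma>) (signed_fourier \<sigma> (f n)) (f n)"
        by (rule fourier_value_cong_AE[OF k fourier_value_inversion_L1_L2[OF f(1) \<sigma> k] L2_space_measurable[OF f2]])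
      from L2_energy_fourier_value_diff_le[OF this h \<sigma>'] show ?thesis .
    qed
    show "(\<lambda>n. L2_energy (\<lambda>\<xi>. signed_fourier \<sigma> (f n) \<xi> - g \<xi>)) \<longlonglongrightarrow> 0"
      using f(3) unfolding L2_tendsto_iff_energy .
  qed simp
  from L2_tendsto_unique[OF this fourier_valueD(2)[OF h] f(2) fourier_valueD(1)[OF g] f2] show ?thesis .
qed

text \<open>
  With \<open>k\<close> the transform of \<open>cnj h\<close>, inversion gives \<open>k = cnj v\<close>, and the claim becomes the
  multiplication formula for \<open>u\<close> and \<open>cnj h\<close>.
\<close>

lemma fourier_value_parseval:
  fixes u v :: "real ^ 'n \<Rightarrow> complex"
  assumes g: "fourier_value \<sigma> u g" and h: "fourier_value \<sigma> v h" and \<sigma>: "\<bar>\<sigma>\<bar> = 1"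
  shows "(LINT x|lebesgue. g x * cnj (h x)) = (LINT x|lebesgue. u x * cnj (v x))"
proof -
  obtain k where k: "fourier_value \<sigma> (\<lambda>x. cnj (h x)) k"
    using fourier_value_exists[OF L2_space_cnj[OF fourier_valueD(2)[OF h]] \<sigma>] by blast
  have "AE x in lebesgue. k x = cnj (v x)"
    using fourier_value_inversion[OF fourier_value_cnj[OF h], of k] k \<sigma> by simp
  then have ae: "AE x in lebesgue. u x * k x = u x * cnj (v x)"
    by eventually_elim simp
  have "(LINT x|lebesgue. g x * cnj (h x)) = (LINT x|lebesgue. u x * k x)"
    by (rule fourier_value_multiplication[OF g k \<sigma>])
  also have "\<dots> = (LINT x|lebesgue. u x * cnj (v x))"
    by (intro integral_cong_AE borel_measurable_times ae L2_space_measurable[OF fourier_valueD(1)[OF g]]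
        L2_space_measurable[OF fourier_valueD(2)[OF k]]
        L2_space_measurable[OF L2_space_cnj[OF fourier_valueD(1)[OF h]]])
  finally show ?thesis .
qed

lemma fourier_value_convolution:
  fixes G u :: "real ^ 'n \<Rightarrow> complex"
  assumes G: "integrable lebesgue G" and g: "fourier_value \<sigma> u g" and \<sigma>: "\<bar>\<sigma>\<bar> = 1"
  shows "fourier_value \<sigma> (convolution G u) (\<lambda>\<xi>. signed_fourier \<sigma> G \<xi> * g \<xi>)"
proof -
  obtain f where f: "\<And>n. f n \<in> L1_space \<inter> L2_space" "L2_tendsto f u" "L2_tendsto (\<lambda>n. signed_fourier \<sigma> (f n)) g"
    using fourier_valueE[OF g] by blast
  have f2: "f n \<in> L2_space" and f1: "integrable lebesgue (f n)" for n using f(1)[of n] by (auto simp: L1_space_def)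
  have u2: "u \<in> L2_space" and g2: "g \<in> L2_space" using fourier_valueD[OF g] by auto
  define A where "A = (\<integral>\<^sup>+ x. ennreal (cmod (G x)) \<partial>lebesgue)"
  have A: "A\<^sup>2 < top" using G by (simp add: A_def integrable_iff_bounded power2_eq_square ennreal_mult_less_top)
  define C where "C = (LINT x|lebesgue. cmod (G x))"
  have Gm: "signed_fourier \<sigma> G \<in> borel_measurable lebesgue"
    by (intro borel_imp_lebesgue_measurable signed_fourier_measurable G)
  have GC: "cmod (signed_fourier \<sigma> G \<xi>) \<le> C" for \<xi>
    unfolding C_def by (rule norm_signed_fourier_le)
  have conv: "convolution G (f n) \<in> L1_space \<inter> L2_space" for n
    using integrable_convolution[OF G f1] convolution_L2[OF G f2] by (simp add: L1_space_def)
  have 1: "L2_tendsto (\<lambda>n. convolution G (f n)) (convolution G u)"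
  proof (rule L2_tendsto_if_energy_le)
    show "L2_energy (\<lambda>x. convolution G (f n) x - convolution G u x) \<le> A\<^sup>2 * L2_energy (\<lambda>x. f n x - u x)" for n
    proof -
      have "AE x in lebesgue. convolution G (f n) x - convolution G u x = convolution G (\<lambda>x. f n x - u x) x"
        using AE_integrable_convolution[OF G f2[of n]] AE_integrable_convolution[OF G u2]
        by eventually_elim (simp add: convolution_def right_diff_distrib)
      from L2_energy_cong_AE[OF this] show ?thesis
        using L2_energy_convolution_le[OF G L2_space_diff[OF f2 u2]] by (simp add: A_def)
    qed
    show "(\<lambda>n. L2_energy (\<lambda>x. f n x - u x)) \<longlonglongrightarrow> 0"
      using f(2) unfolding L2_tendsto_iff_energy .
  qed (rule A)
  have 2: "L2_tendsto (\<lambda>n. signed_fourier \<sigma> (convolution G (f n))) (\<lambda>\<xi>. signed_fourier \<sigma> G \<xi> * g \<xi>)"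
  proof (rule L2_tendsto_if_energy_le)
    show "L2_energy (\<lambda>\<xi>. signed_fourier \<sigma> (convolution G (f n)) \<xi> - signed_fourier \<sigma> G \<xi> * g \<xi>)
        \<le> ennreal (C\<^sup>2) * L2_energy (\<lambda>\<xi>. signed_fourier \<sigma> (f n) \<xi> - g \<xi>)" for n
      unfolding signed_fourier_convolution[OF G f1] right_diff_distrib[symmetric]
      by (intro L2_energy_mult_le GC L2_space_measurable L2_space_diff signed_fourier_L2 f(1) \<sigma> g2)
    show "(\<lambda>n. L2_energy (\<lambda>\<xi>. signed_fourier \<sigma> (f n) \<xi> - g \<xi>)) \<longlonglongrightarrow> 0"
      using f(3) unfolding L2_tendsto_iff_energy .
  qed simp
  show ?thesis
    unfolding is_L2_extension_value_def
    using conv 1 2 convolution_L2[OF G u2] L2_space_mult[OF g2 Gm GC]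
    by (intro conjI exI[of _ "\<lambda>n. convolution G (f n)"] allI)
qed

section \<open>The Bessel kernel\<close>

text \<open>
  The density of the Gamma distribution with shape \<open>s\<close> and rate 1.
\<close>

definition gamma_density :: "real \<Rightarrow> real \<Rightarrow> real" where
  "gamma_density s t = (if 0 < t then t powr (s - 1) * exp (- t) / Gamma s else 0)"

lemma gamma_density_nonneg [simp]: "0 < s \<Longrightarrow> 0 \<le> gamma_density s t"
  by (simp add: gamma_density_def Gamma_real_pos less_imp_le)

lemma gamma_density_measurable [measurable]: "gamma_density s \<in> borel_measurable borel"
  unfolding gamma_density_def[abs_def] by measurable

text \<open>
  The Laplace transform of the Gamma density, evaluated at \<open>c - 1\<close>.
\<close>

lemma nn_integral_gamma_density:
  assumes s: "0 < s" and c: "0 < c"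
  shows "(\<integral>\<^sup>+ t. ennreal (gamma_density s t * exp (- ((c - 1) * t))) \<partial>lborel) = ennreal (c powr (- s))"
proof -
  let ?f = "\<lambda>t. ennreal (indicator {0..} t * t powr (s - 1) / exp t)"
  have G: "0 < Gamma s" using s by (rule Gamma_real_pos)
  have pt: "ennreal (gamma_density s t * exp (- ((c - 1) * t))) = ennreal (c powr (1 - s) / Gamma s) * ?f (0 + c *\<^sub>R t)" for t
  proof (cases "0 < t")
    case True
    have p: "c powr (1 - s) * (c * t) powr (s - 1) = t powr (s - 1)"
      using c True by (simp add: powr_mult mult.assoc[symmetric] flip: powr_add)
    have "exp (- t) * exp (- ((c - 1) * t)) = exp (- (c * t))"
      unfolding exp_add[symmetric] by (simp add: algebra_simps)
    then have e: "exp (- t) * exp (- ((c - 1) * t)) = 1 / exp (c * t)"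
      by (simp add: exp_minus inverse_eq_divide)
    have "gamma_density s t * exp (- ((c - 1) * t)) = t powr (s - 1) * (exp (- t) * exp (- ((c - 1) * t))) / Gamma s"
      using True by (simp add: gamma_density_def)
    also have "\<dots> = (c powr (1 - s) * (c * t) powr (s - 1)) * (1 / exp (c * t)) / Gamma s"
      by (simp only: p e)
    also have "\<dots> = c powr (1 - s) / Gamma s * (indicator {0..} (c * t) * (c * t) powr (s - 1) / exp (c * t))"
      using True c by simp
    finally have eq: "gamma_density s t * exp (- ((c - 1) * t))
        = c powr (1 - s) / Gamma s * (indicator {0..} (c * t) * (c * t) powr (s - 1) / exp (c * t))" .
    show ?thesis
      unfolding eq real_scaleR_def add_0 by (rule ennreal_mult) (use G in simp_all)
  next
    case False
    then have "c * t \<le> 0" using c by (simp add: mult_le_0_iff)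
    then have "indicator {0..} (c * t) * (c * t) powr (s - 1) = 0"
      by (cases "c * t = 0") (auto simp: indicator_def)
    then show ?thesis using False by (simp add: gamma_density_def)
  qed
  have "ennreal (Gamma s) = (\<integral>\<^sup>+ t. ?f t \<partial>lborel)" by (rule Gamma_conv_nn_integral_real[OF s])
  also have "\<dots> = ennreal c * (\<integral>\<^sup>+ t. ?f (0 + c *\<^sub>R t) \<partial>lborel)"
    using nn_integral_lborel_affine[of ?f c "0 :: real"] c by simp
  finally have eq: "ennreal (Gamma s) = ennreal c * (\<integral>\<^sup>+ t. ?f (0 + c *\<^sub>R t) \<partial>lborel)" .
  have cc: "c powr (1 - s) / Gamma s = c powr (- s) / Gamma s * c"
    using c by (simp add: powr_diff powr_minus field_simps)
  have "(\<integral>\<^sup>+ t. ennreal (gamma_density s t * exp (- ((c - 1) * t))) \<partial>lborel)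
      = ennreal (c powr (1 - s) / Gamma s) * (\<integral>\<^sup>+ t. ?f (0 + c *\<^sub>R t) \<partial>lborel)"
    unfolding pt by (rule nn_integral_cmult) measurable
  also have "\<dots> = ennreal (c powr (- s) / Gamma s) * (ennreal c * (\<integral>\<^sup>+ t. ?f (0 + c *\<^sub>R t) \<partial>lborel))"
    unfolding cc using G c by (subst ennreal_mult) (simp_all add: mult.assoc)
  also have "\<dots> = ennreal (c powr (- s) / Gamma s) * ennreal (Gamma s)"
    unfolding eq ..
  also have "\<dots> = ennreal (c powr (- s))"
    using G by (simp flip: ennreal_mult)
  finally show ?thesis .
qed

lemma
  assumes s: "0 < s" and c: "0 < c"
  shows integrable_gamma_density: "integrable lborel (\<lambda>t. gamma_density s t * exp (- ((c - 1) * t)))"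
    and integral_gamma_density: "(LINT t|lborel. gamma_density s t * exp (- ((c - 1) * t))) = c powr (- s)"
proof -
  have "has_bochner_integral lborel (\<lambda>t. gamma_density s t * exp (- ((c - 1) * t))) (c powr (- s))"
    by (rule has_bochner_integral_nn_integral) (use assms nn_integral_gamma_density[OF s c] in auto)
  then show "integrable lborel (\<lambda>t. gamma_density s t * exp (- ((c - 1) * t)))"
    "(LINT t|lborel. gamma_density s t * exp (- ((c - 1) * t))) = c powr (- s)"
    by (auto simp: has_bochner_integral_iff)
qed

text \<open>
  The heat kernel at time \<open>t\<close>: the real-valued version of \<open>gauss_kernel (4 * pi * t)\<close>, with Fourier
  transform \<open>exp (-4 \<pi>\<^sup>2 |\<xi>|\<^sup>2 t)\<close>.  Only \<open>t > 0\<close> is meaningful; \<open>gamma_density\<close> vanishes elsewhere.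
\<close>

definition heat_kernel :: "real \<Rightarrow> real ^ 'n \<Rightarrow> real" where
  "heat_kernel t x = gaussian (1 / (4 * pi * t)) x / sqrt (4 * pi * t) ^ CARD('n)"

lemma heat_kernel_nonneg [simp]: "0 < t \<Longrightarrow> 0 \<le> heat_kernel t x"
  by (simp add: heat_kernel_def)

lemma heat_kernel_measurable [measurable]:
  "(\<lambda>(t, x :: real ^ 'n). heat_kernel t x) \<in> borel_measurable (lborel \<Otimes>\<^sub>M lborel)"
  unfolding heat_kernel_def[abs_def] gaussian_def[abs_def] by measurable

lemma
  assumes t: "0 < t"
  shows integrable_heat_kernel: "integrable lborel (heat_kernel t :: real ^ 'n \<Rightarrow> real)"
    and integral_heat_kernel: "(LINT x|lborel. heat_kernel t (x :: real ^ 'n)) = 1"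
  unfolding heat_kernel_def[abs_def]
  using t by (auto simp: integrable_gaussian integral_gaussian real_sqrt_divide power_divide)

lemma signed_fourier_heat_kernel:
  fixes \<xi> :: "real ^ 'n"
  assumes t: "0 < t" and \<sigma>: "\<bar>\<sigma>\<bar> = 1"
  shows "signed_fourier \<sigma> (\<lambda>x. of_real (heat_kernel t x)) \<xi> = of_real (exp (- (4 * pi\<^sup>2 * (norm \<xi>)\<^sup>2 * t)))"
proof -
  let ?a = "4 * pi * t"
  have a: "0 < ?a" using t by simp
  have "signed_fourier \<sigma> (\<lambda>x. of_real (heat_kernel t x)) \<xi>
      = signed_fourier \<sigma> (\<lambda>x. of_real (gaussian (1 / ?a) x)) \<xi> / of_real (sqrt ?a ^ CARD('n))"
    unfolding signed_fourier_def heat_kernel_def of_real_divide times_divide_eq_right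
    by (rule Bochner_Integration.integral_divide_zero)
  also have "\<dots> = of_real (gaussian ?a \<xi>)"
    using t \<sigma> by (subst signed_fourier_gaussian) (simp_all add: real_sqrt_divide power_divide)
  also have "gaussian ?a \<xi> = exp (- (4 * pi\<^sup>2 * (norm \<xi>)\<^sup>2 * t))"
    by (simp add: gaussian_def power2_eq_square mult_ac)
  finally show ?thesis .
qed

lemma integrable_gamma_heat:
  assumes s: "0 < s"
  shows "integrable (lborel \<Otimes>\<^sub>M lborel) (\<lambda>(t, x :: real ^ 'n). gamma_density s t * heat_kernel t x)"
proof (rule lborel_pair.Fubini_integrable)
  show "(\<lambda>(t, x :: real ^ 'n). gamma_density s t * heat_kernel t x) \<in> borel_measurable (lborel \<Otimes>\<^sub>M lborel)"
    by measurable
  have "(LINT x|lborel. norm (gamma_density s t * heat_kernel t (x :: real ^ 'n))) = gamma_density s t" for t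
  proof (cases "0 < t")
    case True
    then show ?thesis using s by (simp add: abs_mult integral_heat_kernel)
  qed (simp add: gamma_density_def)
  moreover have "integrable lborel (gamma_density s)"
    using integrable_gamma_density[OF s, of 1] by simp
  ultimately show "integrable lborel (\<lambda>t. LINT x|lborel. norm (case (t, x :: real ^ 'n) of (t, x) \<Rightarrow> gamma_density s t * heat_kernel t x))"
    by simp
  have "integrable lborel (\<lambda>x :: real ^ 'n. gamma_density s t * heat_kernel t x)" for t
    by (cases "0 < t") (simp_all add: integrable_heat_kernel gamma_density_def)
  then show "AE t in lborel. integrable lborel (\<lambda>x :: real ^ 'n. case (t, x) of (t, x) \<Rightarrow> gamma_density s t * heat_kernel t x)"
    by simp
qed

lemma is_bessel_kernel_subordination:
  assumes s: "0 < s"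
  shows "is_bessel_kernel (2 * s) (\<lambda>x :: real ^ 'n. LINT t|lborel. gamma_density s t * heat_kernel t x)"
proof -
  define G where "G x = (LINT t|lborel. gamma_density s t * heat_kernel t x)" for x :: "real ^ 'n"
  note int = integrable_gamma_heat[OF s, where 'n = 'n]
  have hk [measurable]: "(\<lambda>t. heat_kernel t x) \<in> borel_measurable borel" for x :: "real ^ 'n"
    unfolding heat_kernel_def gaussian_def by measurable
  have [measurable]: "G \<in> borel_measurable borel"
    unfolding G_def[abs_def] by measurable
  have Gint: "integrable lebesgue G"
    using lborel_pair.integrable_snd[OF int] by (subst integrable_completion) (auto simp: G_def[abs_def])
  have "signed_fourier (-1) (\<lambda>x. of_real (G x)) \<xi> = of_real (bessel_weight (- s) \<xi>)" for \<xi>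
  proof -
    define c where "c x = cis (2 * pi * - 1 * (\<xi> \<bullet> x))" for x
    have [measurable]: "c \<in> borel_measurable borel" unfolding c_def[abs_def] by measurable
    have intc: "integrable (lborel \<Otimes>\<^sub>M lborel) (\<lambda>(t, x). c x * complex_of_real (gamma_density s t * heat_kernel t x))"
      by (rule Bochner_Integration.integrable_bound[OF int])
         (auto simp: c_def norm_mult intro!: borel_measurable_times)
    have "signed_fourier (-1) (\<lambda>x. of_real (G x)) \<xi> = (LINT x|lborel. c x * of_real (G x))"
      unfolding c_def by (rule signed_fourier_borel) measurable
    also have "\<dots> = (LINT x|lborel. LINT t|lborel. c x * complex_of_real (gamma_density s t * heat_kernel t x))"
      unfolding G_def integral_complex_of_real[symmetric] integral_mult_right_zero ..
    also have "\<dots> = (LINT t|lborel. LINT x|lborel. c x * complex_of_real (gamma_density s t * heat_kernel t x))"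
      by (rule lborel_pair.Fubini_integral[OF intc])
    also have "\<dots> = (LINT t|lborel. complex_of_real (gamma_density s t * exp (- (((1 + 4 * pi\<^sup>2 * (norm \<xi>)\<^sup>2) - 1) * t))))"
    proof (rule Bochner_Integration.integral_cong[OF refl])
      fix t
      show "(LINT x|lborel. c x * complex_of_real (gamma_density s t * heat_kernel t x))
        = complex_of_real (gamma_density s t * exp (- (((1 + 4 * pi\<^sup>2 * (norm \<xi>)\<^sup>2) - 1) * t)))"
      proof (cases "0 < t")
        case True
        have "(\<lambda>x. complex_of_real (heat_kernel t (x :: real ^ 'n))) \<in> borel_measurable borel"
          using integrable_heat_kernel[OF True, where 'n = 'n] by (auto dest: borel_measurable_integrable)
        then have "(LINT x|lborel. c x * complex_of_real (heat_kernel t x)) = signed_fourier (-1) (\<lambda>x. of_real (heat_kernel t x)) \<xi>"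
          unfolding c_def by (rule signed_fourier_borel[symmetric])
        also have "\<dots> = of_real (exp (- (((1 + 4 * pi\<^sup>2 * (norm \<xi>)\<^sup>2) - 1) * t)))"
          by (simp add: signed_fourier_heat_kernel[OF True])
        finally have "of_real (gamma_density s t) * (LINT x|lborel. c x * complex_of_real (heat_kernel t x))
          = complex_of_real (gamma_density s t * exp (- (((1 + 4 * pi\<^sup>2 * (norm \<xi>)\<^sup>2) - 1) * t)))"
          by (simp only: of_real_mult)
        then show ?thesis
          unfolding integral_mult_right_zero[symmetric] of_real_mult by (simp only: mult.left_commute)
      qed (simp add: gamma_density_def)
    qed
    also have "\<dots> = of_real (bessel_weight (- s) \<xi>)"
      by (subst integral_complex_of_real, subst integral_gamma_density)
         (simp_all add: s bessel_weight_def add_pos_nonneg)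
    finally show ?thesis .
  qed
  with Gint show ?thesis
    unfolding is_bessel_kernel_def fourier_integral_eq_signed by (simp add: G_def[abs_def])
qed

lemma bessel_kernel_is_bessel_kernel:
  assumes "0 < s" shows "is_bessel_kernel (2 * s) (bessel_kernel (2 * s) :: real ^ 'n \<Rightarrow> real)"
  unfolding bessel_kernel_def
  by (rule someI[of "is_bessel_kernel (2 * s)", OF is_bessel_kernel_subordination[OF assms]])

section \<open>The adjoint of the Sobolev embedding\<close>

lemma fourier_value_L2_fourier:
  assumes "u \<in> L2_space" shows "fourier_value (-1) u (L2_fourier u)"
proof -
  obtain g where "fourier_value (-1) u g" using fourier_value_exists[OF assms, of "-1"] by auto
  then show ?thesis unfolding L2_fourier_def fourier_integral_eq_signed by (rule someI[of "fourier_value (-1) u"])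
qed

lemma fourier_value_L2_inv_fourier:
  assumes "u \<in> L2_space" shows "fourier_value 1 u (L2_inv_fourier u)"
proof -
  obtain g where "fourier_value 1 u g" using fourier_value_exists[OF assms, of 1] by auto
  then show ?thesis unfolding L2_inv_fourier_def inv_fourier_integral_eq_signed by (rule someI[of "fourier_value 1 u"])
qed

lemma bessel_weight_base: "1 \<le> 1 + 4 * pi\<^sup>2 * (norm \<xi>)\<^sup>2"
  by simp

lemma bessel_weight_add: "bessel_weight a \<xi> * bessel_weight b \<xi> = bessel_weight (a + b) \<xi>"
  by (simp add: bessel_weight_def powr_add)

lemma bessel_weight_mult_complex:
  "complex_of_real (bessel_weight a \<xi>) * (complex_of_real (bessel_weight b \<xi>) * z) = complex_of_real (bessel_weight (a + b) \<xi>) * z"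
  unfolding bessel_weight_add[symmetric] of_real_mult by (rule mult.assoc[symmetric])

lemma bessel_weight_pos [simp]: "0 < bessel_weight a \<xi>"
  using less_le_trans[OF zero_less_one bessel_weight_base[of \<xi>]] by (simp add: bessel_weight_def)

lemma bessel_weight_nonzero [simp]: "bessel_weight a \<xi> \<noteq> 0"
  using bessel_weight_pos[of a \<xi>] by linarith

lemma bessel_weight_0 [simp]: "bessel_weight 0 \<xi> = 1"
  using less_le_trans[OF zero_less_one bessel_weight_base[of \<xi>]] by (simp add: bessel_weight_def)

lemma bessel_weight_le_1: "a \<le> 0 \<Longrightarrow> bessel_weight a \<xi> \<le> 1"
  using powr_mono[of a 0, OF _ bessel_weight_base[of \<xi>]] bessel_weight_0[of \<xi>]
  by (simp add: bessel_weight_def)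

lemma bessel_weight_measurable: "(\<lambda>\<xi>. complex_of_real (bessel_weight a \<xi>)) \<in> borel_measurable lebesgue"
  unfolding bessel_weight_def by (intro borel_imp_lebesgue_measurable) measurable

text \<open>
  The condition on the inverse transform in \<open>Hs_space\<close> holds automatically for square integrable
  arguments.
\<close>

lemma Hs_space_iff:
  "u \<in> Hs_space s \<longleftrightarrow> u \<in> L2_space \<and> (\<lambda>\<xi>. of_real (bessel_weight (s / 2) \<xi>) * L2_fourier u \<xi>) \<in> L2_space"
  unfolding Hs_space_def Let_def using fourier_valueD(2)[OF fourier_value_L2_inv_fourier] by blast

lemma Hs_inner_eq_L2_inner:
  "Hs_inner s u v = L2_inner (\<lambda>\<xi>. of_real (bessel_weight (s / 2) \<xi>) * L2_fourier u \<xi>)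
    (\<lambda>\<xi>. of_real (bessel_weight (s / 2) \<xi>) * L2_fourier v \<xi>)"
proof -
  have eq: "of_real (bessel_weight s \<xi>) = (of_real (bessel_weight (s / 2) \<xi>) * of_real (bessel_weight (s / 2) \<xi>) :: complex)" for \<xi> :: "real ^ 'n"
    by (simp add: bessel_weight_add flip: of_real_mult)
  show ?thesis unfolding Hs_inner_def L2_inner_def eq by (simp add: mult_ac)
qed

lemma L2_fourier_inj_AE:
  fixes u v :: "real ^ 'n \<Rightarrow> complex"
  assumes "u \<in> L2_space" "v \<in> L2_space" "AE \<xi> in lebesgue. L2_fourier u \<xi> = L2_fourier v \<xi>"
  shows "AE x in lebesgue. u x = v x"
proof -
  note Fu = fourier_value_L2_fourier[OF assms(1)] and Fv = fourier_value_L2_fourier[OF assms(2)]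
  note Iu = fourier_value_L2_inv_fourier[OF fourier_valueD(2)[OF Fu]]
    and Iv = fourier_value_L2_inv_fourier[OF fourier_valueD(2)[OF Fv]]
  have "AE x in lebesgue. L2_inv_fourier (L2_fourier u) x = u x"
    using fourier_value_inversion[OF Fu] Iu by simp
  moreover have "AE x in lebesgue. L2_inv_fourier (L2_fourier v) x = v x"
    using fourier_value_inversion[OF Fv] Iv by simp
  moreover have "AE x in lebesgue. L2_inv_fourier (L2_fourier u) x = L2_inv_fourier (L2_fourier v) x"
    by (rule fourier_value_unique[OF Iu Iv assms(3)]) simp
  ultimately show ?thesis by eventually_elim simp
qed

lemma AE_eq_if_L2_inner_eq:
  assumes A: "A \<in> L2_space" and B: "B \<in> L2_space"
    and "L2_inner A A = L2_inner B A" "L2_inner A B = L2_inner B B"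
  shows "AE x in lebesgue. A x = B x"
proof -
  note i = integrable_L2_mult[OF A L2_space_cnj[OF A]] integrable_L2_mult[OF B L2_space_cnj[OF A]]
    integrable_L2_mult[OF A L2_space_cnj[OF B]] integrable_L2_mult[OF B L2_space_cnj[OF B]]
  have D: "(\<lambda>x. A x - B x) \<in> L2_space" by (rule L2_space_diff[OF A B])
  then have int: "integrable lebesgue (\<lambda>x. (cmod (A x - B x))\<^sup>2)" by (simp add: L2_space_def)
  have "complex_of_real (LINT x|lebesgue. (cmod (A x - B x))\<^sup>2)
      = (LINT x|lebesgue. (A x * cnj (A x) - B x * cnj (A x)) - (A x * cnj (B x) - B x * cnj (B x)))"
    unfolding integral_complex_of_real[symmetric]
    by (intro Bochner_Integration.integral_cong refl)
       (simp add: complex_norm_square algebra_simps del: of_real_power)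
  also have "\<dots> = (L2_inner A A - L2_inner B A) - (L2_inner A B - L2_inner B B)"
    unfolding L2_inner_def by (simp add: i)
  also have "\<dots> = 0" using assms(3,4) by simp
  finally have "(LINT x|lebesgue. (cmod (A x - B x))\<^sup>2) = 0" by (simp only: of_real_eq_0_iff)
  then have "AE x in lebesgue. (cmod (A x - B x))\<^sup>2 = 0"
    by (subst (asm) integral_nonneg_eq_0_iff_AE[OF int]) auto
  then show ?thesis by eventually_elim simp
qed

text \<open>
  Testing with \<open>v = a\<close> and with \<open>v = b\<close> already suffices.
\<close>

lemma Hs_inner_determines_AE:
  assumes a: "a \<in> Hs_space s" and b: "b \<in> Hs_space s"
    and eq: "\<And>v. v \<in> Hs_space s \<Longrightarrow> Hs_inner s a v = Hs_inner s b v"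
  shows "AE x in lebesgue. a x = b x"
proof (rule L2_fourier_inj_AE)
  have "AE \<xi> in lebesgue. of_real (bessel_weight (s / 2) \<xi>) * L2_fourier a \<xi>
      = of_real (bessel_weight (s / 2) \<xi>) * L2_fourier b \<xi>"
    using a b eq[OF a] eq[OF b] unfolding Hs_inner_eq_L2_inner
    by (intro AE_eq_if_L2_inner_eq) (auto simp: Hs_space_iff)
  then show "AE \<xi> in lebesgue. L2_fourier a \<xi> = L2_fourier b \<xi>"
    by eventually_elim simp
qed (use a b in \<open>auto simp: Hs_space_iff\<close>)

lemma
  fixes G :: "real ^ 'n \<Rightarrow> real"
  assumes G: "is_bessel_kernel (2 * s) G" and s: "0 < s" and u: "u \<in> L2_space"
  shows convolution_bessel_kernel_in_Hs: "convolution (\<lambda>z. of_real (G z)) u \<in> Hs_space s"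
    and Hs_inner_convolution_bessel_kernel:
      "v \<in> L2_space \<Longrightarrow> Hs_inner s (convolution (\<lambda>z. of_real (G z)) u) v = L2_inner u v"
proof -
  let ?G = "\<lambda>z. complex_of_real (G z)"
  let ?k = "convolution ?G u"
  have Gi: "integrable lebesgue ?G" and FG: "signed_fourier (-1) ?G = (\<lambda>\<xi>. of_real (bessel_weight (- s) \<xi>))"
    using G by (auto simp: is_bessel_kernel_def fourier_integral_eq_signed fun_eq_iff)
  have k: "?k \<in> L2_space" by (rule convolution_L2[OF Gi u])
  note Fu = fourier_value_L2_fourier[OF u] and Fk = fourier_value_L2_fourier[OF k]
  have "fourier_value (-1) ?k (\<lambda>\<xi>. of_real (bessel_weight (- s) \<xi>) * L2_fourier u \<xi>)"
    using fourier_value_convolution[OF Gi Fu] unfolding FG by simp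
  then have Fk_eq: "AE \<xi> in lebesgue. L2_fourier ?k \<xi> = of_real (bessel_weight (- s) \<xi>) * L2_fourier u \<xi>"
    by (intro fourier_value_unique[OF Fk]) auto
  have mk: "L2_fourier ?k \<in> borel_measurable lebesgue" and mu: "L2_fourier u \<in> borel_measurable lebesgue"
    using L2_space_measurable[OF fourier_valueD(2)] Fk Fu by blast+
  have L2: "(\<lambda>\<xi>. of_real (bessel_weight (- s / 2) \<xi>) * L2_fourier u \<xi>) \<in> L2_space"
    using bessel_weight_le_1[of "- s / 2"] s
    by (intro L2_space_mult[of _ _ 1] fourier_valueD(2)[OF Fu] bessel_weight_measurable)
       (simp add: abs_of_pos)
  have ae: "AE \<xi> in lebesgue. of_real (bessel_weight (- s / 2) \<xi>) * L2_fourier u \<xi>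
      = of_real (bessel_weight (s / 2) \<xi>) * L2_fourier ?k \<xi>"
    using Fk_eq
  proof eventually_elim
    case (elim \<xi>)
    have "- s / 2 = s / 2 + - s" by simp
    then show ?case unfolding elim bessel_weight_mult_complex by (simp only:)
  qed
  have "(\<lambda>\<xi>. of_real (bessel_weight (s / 2) \<xi>) * L2_fourier ?k \<xi>) \<in> L2_space"
    by (rule L2_space_cong_AE[OF L2 _ ae]) (rule borel_measurable_times[OF bessel_weight_measurable mk])
  with k show "?k \<in> Hs_space s" by (simp add: Hs_space_iff)
  assume v: "v \<in> L2_space"
  note Fv = fourier_value_L2_fourier[OF v]
  have mv: "(\<lambda>\<xi>. cnj (L2_fourier v \<xi>)) \<in> borel_measurable lebesgue"
    by (rule L2_space_measurable[OF L2_space_cnj[OF fourier_valueD(2)[OF Fv]]])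
  have "Hs_inner s ?k v = (LINT \<xi>|lebesgue. L2_fourier u \<xi> * cnj (L2_fourier v \<xi>))"
    unfolding Hs_inner_def
  proof (intro integral_cong_AE borel_measurable_times bessel_weight_measurable mk mu mv)
    show "AE \<xi> in lebesgue. of_real (bessel_weight s \<xi>) * L2_fourier ?k \<xi> * cnj (L2_fourier v \<xi>)
        = L2_fourier u \<xi> * cnj (L2_fourier v \<xi>)"
      using Fk_eq by eventually_elim (simp add: bessel_weight_mult_complex)
  qed
  also have "\<dots> = L2_inner u v"
    unfolding L2_inner_def by (rule fourier_value_parseval[OF Fu Fv]) simp
  finally show "Hs_inner s ?k v = L2_inner u v" .
qed

theorem proposition5p1:
  fixes s :: real
  assumes "0 < s"
  shows "is_bessel_kernel (2 * s) (bessel_kernel (2 * s) :: real ^ 'n \<Rightarrow> real) \<and>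
    (\<exists>S :: (real ^ 'n \<Rightarrow> complex) \<Rightarrow> real ^ 'n \<Rightarrow> complex. is_Hs_embedding_adjoint s S) \<and>
    (\<forall>S :: (real ^ 'n \<Rightarrow> complex) \<Rightarrow> real ^ 'n \<Rightarrow> complex. is_Hs_embedding_adjoint s S \<longrightarrow>
      (\<forall>u \<in> L2_space. AE x in lebesgue.
         integrable lebesgue (\<lambda>y. of_real (bessel_kernel (2 * s) (x - y)) * u y) \<and>
         S u x = convolution (\<lambda>z. of_real (bessel_kernel (2 * s) z)) u x))"
proof (intro conjI allI impI ballI)
  let ?G = "bessel_kernel (2 * s) :: real ^ 'n \<Rightarrow> real"
  let ?C = "convolution (\<lambda>z. complex_of_real (?G z))"
  show G: "is_bessel_kernel (2 * s) ?G" by (rule bessel_kernel_is_bessel_kernel[OF assms])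
  have C: "is_Hs_embedding_adjoint s ?C"
    unfolding is_Hs_embedding_adjoint_def Hs_embedding_def
    using convolution_bessel_kernel_in_Hs[OF G assms] Hs_inner_convolution_bessel_kernel[OF G assms]
    by (auto simp: Hs_space_iff)
  then show "\<exists>S :: (real ^ 'n \<Rightarrow> complex) \<Rightarrow> real ^ 'n \<Rightarrow> complex. is_Hs_embedding_adjoint s S" by blast
  fix S :: "(real ^ 'n \<Rightarrow> complex) \<Rightarrow> real ^ 'n \<Rightarrow> complex" and u :: "real ^ 'n \<Rightarrow> complex"
  assume S: "is_Hs_embedding_adjoint s S" and u: "u \<in> L2_space"
  have "AE x in lebesgue. S u x = ?C u x"
    using S C u unfolding is_Hs_embedding_adjoint_def
    by (intro Hs_inner_determines_AE) auto
  moreover have "integrable lebesgue (\<lambda>z. complex_of_real (?G z))"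
    using G by (simp add: is_bessel_kernel_def)
  then have "AE x in lebesgue. integrable lebesgue (\<lambda>y. complex_of_real (?G (x - y)) * u y)"
    by (rule AE_integrable_convolution[OF _ u])
  ultimately show "AE x in lebesgue. integrable lebesgue (\<lambda>y. complex_of_real (?G (x - y)) * u y) \<and> S u x = ?C u x"
    by eventually_elim simp
qed

end
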